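(* Let $p,q\ge 1$ be integers, let $A_1,\dots,A_p>0$, $B_1,\dots,B_q>0$, $a_1,\dots,a_p\ge 0$, $b_1,\dots,b_q\ge 0$, and suppose that $$\mu:=\sum_{j=1}^{q}b_j-\sum_{i=1}^{p}a_i+\frac{p-q}{2}>0,\qquad \rho:=\prod_{i=1}^{p}A_i^{A_i}\prod_{j=1}^{q}B_j^{-B_j}\le 1,\qquad \sum_{i=1}^{p}A_i=\sum_{j=1}^{q}B_j.$$ Then for all $x\in(0,\rho)$ $$H^{p,0}_{q,p}\left(x\left|\begin{array}{l}(\mathbf B,\mathbf b)\\(\mathbf A,\mathbf a)\end{array}\right.\right)=\frac{1}{\log(\rho/x)}\int_{x/\rho}^{1}H^{p,0}_{q,p}\left(\frac{x}{u}\left|\begin{array}{l}(\mathbf B,\mathbf b)\\(\mathbf A,\mathbf a)\end{array}\right.\right)\frac{Q(u)}{u}\,du,$$ where $$Q(t)=\sum_{i=1}^{p}\frac{t^{a_i/A_i}}{1-t^{1/A_i}}-\sum_{j=1}^{q}\frac{t^{b_j/B_j}}{1-t^{1/B_j}},\qquad t\in(0,1).$$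
   Context: Fox's $H$-function: with $\gamma=-\min_{1\le k\le p}(a_k/A_k)$ and any $c>\gamma$, for $z>0$, $$H^{p,0}_{q,p}\left(z\left|\begin{array}{l}(\mathbf B,\mathbf b)\\(\mathbf A,\mathbf a)\end{array}\right.\right)=\lim_{R\to\infty}\frac{1}{2\pi i}\int_{c-iR}^{c+iR}\frac{\prod_{k=1}^{p}\Gamma(A_ks+a_k)}{\prod_{j=1}^{q}\Gamma(B_js+b_j)}z^{-s}\,ds,$$ which exists for all $z>0$ except possibly $z=\rho$ when $\mu>0$ and $\sum_iA_i=\sum_jB_j$. *)

theory Defs
  imports "HOL-Complex_Analysis.Complex_Analysis"
begin

text \<open>
  Parameter vectors are functions on \<open>nat\<close>; only the entries with index in \<open>{1..p}\<close>
  (for \<open>A\<close>, \<open>a\<close>) and \<open>{1..q}\<close> (for \<open>B\<close>, \<open>b\<close>) are used.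
\<close>

definition fox_gamma :: "nat \<Rightarrow> (nat \<Rightarrow> real) \<Rightarrow> (nat \<Rightarrow> real) \<Rightarrow> real" where
  "fox_gamma p A a = - Min ((\<lambda>k. a k / A k) ` {1..p})"

text \<open>
  Since \<open>Gamma\<close> takes the value 0 at its poles and division by 0 yields 0, the quotient below
  agrees with the product of the entire functions \<open>1 / Gamma\<close> also where some \<open>B j * s + b j\<close>
  is a non-positive integer.
\<close>

definition fox_integrand ::
  "nat \<Rightarrow> nat \<Rightarrow> (nat \<Rightarrow> real) \<Rightarrow> (nat \<Rightarrow> real) \<Rightarrow> (nat \<Rightarrow> real) \<Rightarrow> (nat \<Rightarrow> real) \<Rightarrow>
    real \<Rightarrow> complex \<Rightarrow> complex" where
  "fox_integrand p q A a B b z s =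
     (\<Prod>k=1..p. Gamma (of_real (A k) * s + of_real (a k))) /
     (\<Prod>j=1..q. Gamma (of_real (B j) * s + of_real (b j))) * of_real z powr (- s)"

text \<open>
  The function \<open>H\<close> with upper indices \<open>(p, 0)\<close> and lower indices \<open>(q, p)\<close>. The abscissa \<open>c\<close> of
  the line of integration is arbitrary to the right of \<open>fox_gamma\<close>, so the value is the common
  limit over all such \<open>c\<close>; it is unspecified where there is no such limit.
\<close>

definition has_fox_H ::
  "nat \<Rightarrow> nat \<Rightarrow> (nat \<Rightarrow> real) \<Rightarrow> (nat \<Rightarrow> real) \<Rightarrow> (nat \<Rightarrow> real) \<Rightarrow> (nat \<Rightarrow> real) \<Rightarrow>
    real \<Rightarrow> complex \<Rightarrow> bool" where
  "has_fox_H p q A a B b z L \<longleftrightarrow>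
     (\<forall>c > fox_gamma p A a.
        ((\<lambda>R. 1 / (2 * of_real pi * \<i>) *
               contour_integral (linepath (Complex c (- R)) (Complex c R))
                 (fox_integrand p q A a B b z)) \<longlongrightarrow> L) at_top)"

definition fox_H ::
  "nat \<Rightarrow> nat \<Rightarrow> (nat \<Rightarrow> real) \<Rightarrow> (nat \<Rightarrow> real) \<Rightarrow> (nat \<Rightarrow> real) \<Rightarrow> (nat \<Rightarrow> real) \<Rightarrow>
    real \<Rightarrow> complex" where
  "fox_H p q A a B b z = (THE L. has_fox_H p q A a B b z L)"

definition fox_mu :: "nat \<Rightarrow> nat \<Rightarrow> (nat \<Rightarrow> real) \<Rightarrow> (nat \<Rightarrow> real) \<Rightarrow> real" where
  "fox_mu p q a b = (\<Sum>j=1..q. b j) - (\<Sum>i=1..p. a i) + (real p - real q) / 2"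

definition fox_rho :: "nat \<Rightarrow> nat \<Rightarrow> (nat \<Rightarrow> real) \<Rightarrow> (nat \<Rightarrow> real) \<Rightarrow> real" where
  "fox_rho p q A B = (\<Prod>i=1..p. A i powr A i) * (\<Prod>j=1..q. B j powr (- B j))"

definition fox_Q ::
  "nat \<Rightarrow> nat \<Rightarrow> (nat \<Rightarrow> real) \<Rightarrow> (nat \<Rightarrow> real) \<Rightarrow> (nat \<Rightarrow> real) \<Rightarrow> (nat \<Rightarrow> real) \<Rightarrow>
    real \<Rightarrow> real" where
  "fox_Q p q A a B b t =
     (\<Sum>i=1..p. t powr (a i / A i) / (1 - t powr (1 / A i))) -
     (\<Sum>j=1..q. t powr (b j / B j) / (1 - t powr (1 / B j)))"

end

theory Submission
  imports Defs "HOL-Real_Asymp.Real_Asymp"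
begin

text \<open>
  Let \<open>M s\<close> be the quotient of the two products of gamma functions, so that \<open>H\<close> is the inverse
  Mellin transform of \<open>M\<close>. Binet's integral for the digamma function shows that, for \<open>Re s \<ge> 1\<close>,
  the logarithmic derivative of \<open>M\<close> is \<open>ln \<rho> - F s\<close>, where \<open>F\<close> is the Mellin transform of \<open>Q\<close>
  on the unit interval (\<open>Digamma_conv_unit_mellin\<close>, \<open>D_eq\<close>): the constants \<open>A ln A\<close> and
  \<open>- B ln B\<close> add up to \<open>ln \<rho>\<close>, and the terms in \<open>Ln s\<close> cancel since \<open>\<Sum>A = \<Sum>B\<close>. Consequently
  \<open>P s = M s * y powr (-s)\<close> solves the differential equation \<open>P' = (ln (\<rho> / y) - F) P\<close>.
  Integrate it along a vertical line. The derivative contributes boundary terms, which vanish in the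
  limit. The factor \<open>u powr (s - 1)\<close> of the kernel of \<open>F\<close> replaces \<open>y powr (-s)\<close> by
  \<open>(y / u) powr (-s) / u\<close>, so that the product \<open>F P\<close> integrates to a mean of \<open>H (y / u)\<close> with the
  weight \<open>Q u / u\<close>. This is the asserted equation with the integral taken over all of \<open>{0<..<1}\<close>;
  the part below \<open>x / \<rho>\<close> is zero because \<open>H\<close> vanishes beyond \<open>\<rho>\<close>.

  The analysis rests on two bounds. First, \<open>Q\<close> is bounded and tends to \<open>\<mu> > 0\<close> at \<open>1\<close>. Comparing
  \<open>Q\<close> with a constant \<open>\<nu> < \<mu>\<close>, for which the primitive of the transform is \<open>\<nu> Ln s\<close> by
  Frullani's integral, yields \<open>M s = O(\<rho> powr Re s * \<bar>s\<bar> powr (-\<nu>))\<close> in the whole half-plane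
  (\<open>M_decay_exists\<close>). Second, \<open>Q\<close> is made up of monotone pieces, whence
  \<open>F s = O(1 / \<bar>s\<bar>)\<close> (\<open>norm_F_le\<close>). With these, the differential equation itself proves that the inversion integral converges for \<open>y \<noteq> \<rho>\<close>
  (\<open>line_integral_tendsto\<close>), with a limit of size \<open>O((\<rho> / y) powr c / \<bar>ln (\<rho> / y)\<bar>)\<close> on the line
  \<open>Re s = c\<close>. Since the limit is the same on all lines, \<open>c \<rightarrow> \<infinity>\<close> gives \<open>H y = 0\<close> for \<open>y > \<rho>\<close>
  (\<open>fox_H_eq_0\<close>). Finally the truncated integrals are bounded by a multiple of
  \<open>\<bar>ln (\<rho> / y)\<bar> powr (\<nu> - 1) / y\<close> uniformly in the height (\<open>norm_line_integral_le\<close>), which is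
  integrable across \<open>y = \<rho>\<close> and permits dominated convergence after exchanging the integrals over
  \<open>u\<close> and over the line (\<open>fox_H_integral_equation\<close>).
\<close>

section \<open>Mellin transforms of bounded functions on the unit interval\<close>

text \<open>
  This is \<open>u powr (s - 1)\<close> for \<open>u > 0\<close>. Through the real logarithm it is visibly measurable in \<open>u\<close>
  and entire in \<open>s\<close>.
\<close>

definition mellin_kernel :: "complex \<Rightarrow> real \<Rightarrow> complex" where
  "mellin_kernel s u = exp (of_real (ln u) * (s - 1))"

definition unit_mellin :: "(real \<Rightarrow> real) \<Rightarrow> complex \<Rightarrow> complex" where
  "unit_mellin w s = (LINT u:{0<..<1}|lborel. w u *\<^sub>R mellin_kernel s u)"

text \<open>
  The antiderivative of \<open>unit_mellin w\<close> that vanishes at \<open>1\<close>.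
\<close>

definition unit_mellin_prim :: "(real \<Rightarrow> real) \<Rightarrow> complex \<Rightarrow> complex" where
  "unit_mellin_prim w s = (LINT u:{0<..<1}|lborel. (w u / ln u) *\<^sub>R (mellin_kernel s u - 1))"

lemma measurable_mellin_kernel [measurable]: "mellin_kernel s \<in> borel_measurable borel"
  unfolding mellin_kernel_def by measurable

lemma norm_mellin_kernel: "norm (mellin_kernel s u) = exp (ln u * (Re s - 1))"
  by (simp add: mellin_kernel_def)

lemma norm_mellin_kernel_le_1:
  assumes "u \<in> {0<..<1}" "Re s \<ge> 1"
  shows   "norm (mellin_kernel s u) \<le> 1"
  using assms by (simp add: norm_mellin_kernel mult_nonpos_nonneg)

lemma mellin_kernel_1 [simp]: "mellin_kernel 1 u = 1"
  by (simp add: mellin_kernel_def)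

lemma mellin_kernel_add: "mellin_kernel (s + z) u = mellin_kernel s u * exp (of_real (ln u) * z)"
  by (simp add: mellin_kernel_def exp_add [symmetric] algebra_simps)

lemma mellin_kernel_add_real:
  assumes "u > 0"
  shows   "mellin_kernel (s + of_real h) u = (u powr h) *\<^sub>R mellin_kernel s u"
  using assms
  by (simp add: mellin_kernel_add powr_def scaleR_conv_of_real mult_ac flip: exp_of_real)

lemma mellin_kernel_deriv:
  "((\<lambda>s. mellin_kernel s u) has_field_derivative of_real (ln u) * mellin_kernel s u) (at s within S)"
  unfolding mellin_kernel_def by (auto intro!: derivative_eq_intros)

lemma convex_halfplane_Re_ge1: "convex {s. Re s \<ge> 1}"
  by (rule convex_halfspace_Re_ge)

lemma mellin_kernel_lipschitz:
  assumes "u \<in> {0<..<1}" "Re s \<ge> 1" "Re z \<ge> 1"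
  shows   "norm (mellin_kernel s u - mellin_kernel z u) \<le> \<bar>ln u\<bar> * norm (s - z)"
proof (rule field_differentiable_bound [OF convex_halfplane_Re_ge1])
  show "((\<lambda>s. mellin_kernel s u) has_field_derivative of_real (ln u) * mellin_kernel w u)
          (at w within {s. Re s \<ge> 1})" for w
    by (rule mellin_kernel_deriv)
  show "norm (complex_of_real (ln u) * mellin_kernel w u) \<le> \<bar>ln u\<bar>" if "w \<in> {s. Re s \<ge> 1}" for w
    using norm_mellin_kernel_le_1 [of u w] assms that
    by (simp add: norm_mult mult_left_le)
qed (use assms in auto)

lemma mellin_kernel_taylor:
  assumes "u \<in> {0<..<1}" "Re s \<ge> 1" "Re z \<ge> 1"
  shows   "norm (mellin_kernel z u - mellin_kernel s u - of_real (ln u) * mellin_kernel s u * (z - s))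
             \<le> (ln u)\<^sup>2 * norm (z - s) ^ 2"
proof -
  define f where "f = (\<lambda>i w. of_real (ln u) ^ i * mellin_kernel w u)"
  have "norm (f 0 z - (\<Sum>i\<le>1. f i s * (z - s) ^ i / fact i)) \<le> (ln u)\<^sup>2 * norm (z - s) ^ Suc 1 / fact 1"
  proof (rule complex_Taylor [OF convex_halfplane_Re_ge1])
    show "(f i has_field_derivative f (Suc i) x) (at x within {s. Re s \<ge> 1})" for i x
      unfolding f_def by (auto intro!: derivative_eq_intros mellin_kernel_deriv)
    show "norm (f (Suc 1) x) \<le> (ln u)\<^sup>2" if "x \<in> {s. Re s \<ge> 1}" for x
      using norm_mellin_kernel_le_1 [of u x] assms that
      by (simp add: f_def norm_mult power2_eq_square mult_left_le norm_power)
  qed (use assms in auto)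
  thus ?thesis
    by (simp add: f_def power2_eq_square algebra_simps)
qed

lemma set_integrable_bounded_open_interval:
  fixes f :: "real \<Rightarrow> 'a :: {banach, second_countable_topology}"
  assumes "f \<in> borel_measurable borel" "\<And>u. u \<in> {a<..<b} \<Longrightarrow> norm (f u) \<le> B"
  shows   "set_integrable lborel {a<..<b} f"
  unfolding set_integrable_def
proof (rule integrableI_bounded_set_indicator [where B = B])
  show "emeasure lborel {a<..<b} < \<infinity>"
    by (cases "a \<le> b") auto
qed (use assms in auto)

lemma norm_set_integral_unit_le:
  fixes f :: "real \<Rightarrow> 'a :: {banach, second_countable_topology}"
  assumes "f \<in> borel_measurable borel" "\<And>u. u \<in> {0<..<1} \<Longrightarrow> norm (f u) \<le> B"
  shows   "norm (LINT u:{0<..<1}|lborel. f u) \<le> B"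
proof -
  have *: "set_integrable lborel {0<..<1} (\<lambda>_::real. B)"
    by (rule set_integrable_bounded_open_interval) auto
  have "norm (LINT u:{0<..<1}|lborel. f u) \<le> (LINT u:{0<..<1::real}|lborel. B)"
    unfolding set_lebesgue_integral_def
  proof (rule Bochner_Integration.integral_norm_bound_integral)
    show "integrable lborel (\<lambda>u. indicat_real {0<..<1} u *\<^sub>R f u)"
      using set_integrable_bounded_open_interval [of f 0 1 B] assms by (simp add: set_integrable_def)
  qed (use * assms in \<open>auto simp: indicator_def set_integrable_def\<close>)
  also have "\<dots> = B"
    by (simp add: set_lebesgue_integral_def)
  finally show ?thesis .
qed

lemma set_integrable_powr_from_0:
  assumes "(r::real) > -1" "c \<ge> 0"
  shows   "set_integrable lborel {0..c} (\<lambda>u. u powr r)"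
proof -
  have "(\<lambda>u. u powr r) absolutely_integrable_on {0..c}"
    using assms by (intro nonnegative_absolutely_integrable_1 integrable_on_powr_from_0) auto
  thus ?thesis
    unfolding set_integrable_def by (subst (asm) integrable_completion) auto
qed

lemma set_integrable_abs_ln: "set_integrable lborel {0<..<1} (\<lambda>u::real. \<bar>ln u\<bar>)"
proof (rule set_integrable_bound)
  show "set_integrable lborel {0<..<1} (\<lambda>u::real. 2 * u powr (-1/2))"
    by (intro set_integrable_mult_right set_integrable_subset [OF set_integrable_powr_from_0 [of "-1/2" 1]]) auto
  have *: "\<bar>ln u\<bar> \<le> 2 * u powr (-1/2)" if "u \<in> {0<..<1}" for u :: real
  proof -
    have "ln (1 / u) \<le> (1 / u) powr (1/2) / (1/2)"
      using that by (intro ln_powr_bound) auto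
    also have "(1 / u) powr (1/2) = u powr (-1/2)"
      using that by (simp add: powr_divide powr_minus_divide)
    finally show ?thesis using that by (simp add: ln_div)
  qed
  show "AE u in lborel. u \<in> {0<..<1} \<longrightarrow> norm \<bar>ln u\<bar> \<le> norm (2 * u powr (-1/2) :: real)"
    using * by (intro AE_I2 impI) (metis abs_ge_self order_trans real_norm_def abs_idempotent)
qed (simp_all add: set_borel_measurable_def)

locale bounded_weight =
  fixes w :: "real \<Rightarrow> real" and K :: real
  assumes measurable_weight [measurable]: "w \<in> borel_measurable borel"
      and weight_le: "\<And>u. u \<in> {0<..<1} \<Longrightarrow> \<bar>w u\<bar> \<le> K"
begin

lemma K_nonneg: "K \<ge> 0"
  using weight_le [of "1/2"] by simp

lemma norm_integrand_le:
  assumes "u \<in> {0<..<1}" "Re s \<ge> 1"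
  shows   "norm (w u *\<^sub>R mellin_kernel s u) \<le> K"
  using mult_mono [OF weight_le [OF assms(1)] norm_mellin_kernel_le_1 [OF assms]] K_nonneg by simp

lemma integrable:
  assumes "Re s \<ge> 1"
  shows   "set_integrable lborel {0<..<1} (\<lambda>u. w u *\<^sub>R mellin_kernel s u)"
  by (rule set_integrable_bounded_open_interval [where B = K], measurable)
     (rule norm_integrand_le [OF _ assms])

lemma norm_prim_integrand_le:
  assumes u: "u \<in> {0<..<1}" and s: "Re s \<ge> 1"
  shows   "norm ((w u / ln u) *\<^sub>R (mellin_kernel s u - 1)) \<le> K * norm (s - 1)"
proof -
  have "norm ((w u / ln u) *\<^sub>R (mellin_kernel s u - 1)) =
          \<bar>w u\<bar> / \<bar>ln u\<bar> * norm (mellin_kernel s u - mellin_kernel 1 u)"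
    by simp
  also have "\<dots> \<le> K / \<bar>ln u\<bar> * (\<bar>ln u\<bar> * norm (s - 1))"
    using mellin_kernel_lipschitz [OF u s, of 1]
    by (intro mult_mono divide_right_mono weight_le [OF u] divide_nonneg_nonneg K_nonneg) auto
  also have "\<dots> = K * norm (s - 1)"
    using u by simp
  finally show ?thesis .
qed

lemma prim_integrable:
  assumes "Re s \<ge> 1"
  shows   "set_integrable lborel {0<..<1} (\<lambda>u. (w u / ln u) *\<^sub>R (mellin_kernel s u - 1))"
  by (rule set_integrable_bounded_open_interval [where B = "K * norm (s - 1)"], measurable)
     (rule norm_prim_integrand_le [OF _ assms])

lemma prim_at_1: "unit_mellin_prim w 1 = 0"
  by (simp add: unit_mellin_prim_def)

text \<open>
  Of the factor \<open>(ln u)\<^sup>2\<close> in the Taylor bound of the kernel, the denominator \<open>ln u\<close> cancels one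
  power, and the remaining \<open>\<bar>ln u\<bar>\<close> is integrable. The error of the difference quotient is thus
  quadratic in \<open>z - s\<close>, also on the boundary line \<open>Re s = 1\<close>.
\<close>

lemma prim_has_field_derivative:
  assumes s: "Re s \<ge> 1"
  shows   "(unit_mellin_prim w has_field_derivative unit_mellin w s) (at s within {s. Re s \<ge> 1})"
proof -
  define I :: real where "I = (LINT u:{0<..<1}|lborel. \<bar>ln u\<bar>)"
  have bound: "norm (unit_mellin_prim w z - unit_mellin_prim w s - unit_mellin w s * (z - s))
                 \<le> K * I * norm (z - s) ^ 2" if z: "Re z \<ge> 1" for z
  proof -
    define D where "D = (\<lambda>u. (w u / ln u) *\<^sub>R (mellin_kernel z u - mellin_kernel s u -
                              of_real (ln u) * mellin_kernel s u * (z - s)))"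
    have D: "((w u / ln u) *\<^sub>R (mellin_kernel z u - 1) - (w u / ln u) *\<^sub>R (mellin_kernel s u - 1)) -
                (w u *\<^sub>R mellin_kernel s u) * (z - s) = D u" if "u \<in> {0<..<1}" for u
      using that by (simp add: D_def scaleR_conv_of_real field_simps)
    note int = prim_integrable [OF z] prim_integrable [OF s]
    note int' = set_integrable_mult_left [of "z - s", OF integrable [OF s]]
    have "unit_mellin_prim w z - unit_mellin_prim w s - unit_mellin w s * (z - s) =
            (LINT u:{0<..<1}|lborel. ((w u / ln u) *\<^sub>R (mellin_kernel z u - 1) -
               (w u / ln u) *\<^sub>R (mellin_kernel s u - 1)) - (w u *\<^sub>R mellin_kernel s u) * (z - s))"
      unfolding set_integral_diff(2) [OF set_integral_diff(1) [OF int] int'] set_integral_diff(2) [OF int]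
      unfolding unit_mellin_prim_def unit_mellin_def set_integral_mult_left ..
    also have "\<dots> = (LINT u:{0<..<1}|lborel. D u)"
      by (rule set_lebesgue_integral_cong) (use D in auto)
    finally have eq: "unit_mellin_prim w z - unit_mellin_prim w s - unit_mellin w s * (z - s) =
                        (LINT u:{0<..<1}|lborel. D u)" .
    have le: "norm (D u) \<le> K * norm (z - s) ^ 2 * \<bar>ln u\<bar>" if u: "u \<in> {0<..<1}" for u
    proof -
      have "norm (D u) \<le> K / \<bar>ln u\<bar> * ((ln u)\<^sup>2 * norm (z - s) ^ 2)"
        unfolding D_def norm_scaleR
        using mellin_kernel_taylor [OF u s z] weight_le [OF u] K_nonneg
        by (intro mult_mono) (auto simp: abs_divide divide_right_mono)
      also have "\<dots> = K * norm (z - s) ^ 2 * \<bar>ln u\<bar>"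
        using u by (simp add: power2_eq_square field_simps)
      finally show ?thesis .
    qed
    have "norm (LINT u:{0<..<1}|lborel. D u) \<le>
             (LINT u:{0<..<1}|lborel. K * norm (z - s) ^ 2 * \<bar>ln u\<bar>)"
      unfolding set_lebesgue_integral_def
    proof (rule Bochner_Integration.integral_norm_bound_integral)
      show int: "integrable lborel (\<lambda>u. indicat_real {0<..<1} u *\<^sub>R (K * norm (z - s) ^ 2 * \<bar>ln u\<bar>))"
        using set_integrable_mult_right [of "K * norm (z - s) ^ 2", OF set_integrable_abs_ln]
        by (simp add: set_integrable_def)
      show "norm (indicat_real {0<..<1} u *\<^sub>R D u) \<le>
              indicat_real {0<..<1} u *\<^sub>R (K * norm (z - s) ^ 2 * \<bar>ln u\<bar>)" for u
        using le [of u] by (simp add: indicator_def)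
      show "integrable lborel (\<lambda>u. indicat_real {0<..<1} u *\<^sub>R D u)"
      proof (rule Bochner_Integration.integrable_bound [OF int])
        show "(\<lambda>u. indicat_real {0<..<1} u *\<^sub>R D u) \<in> borel_measurable lborel"
          unfolding D_def by measurable
        show "AE u in lborel. norm (indicat_real {0<..<1} u *\<^sub>R D u) \<le>
                norm (indicat_real {0<..<1} u *\<^sub>R (K * norm (z - s) ^ 2 * \<bar>ln u\<bar>))"
          using le K_nonneg by (intro AE_I2) (force simp: indicator_def abs_mult)
      qed
    qed
    also have "\<dots> = K * I * norm (z - s) ^ 2"
      by (simp add: I_def)
    finally show ?thesis by (simp add: eq)
  qed
  have lim: "((\<lambda>z. K * I * norm (z - s)) \<longlongrightarrow> 0) (at s within {s. Re s \<ge> 1})"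
    by (auto intro!: tendsto_eq_intros)
  show ?thesis
    unfolding has_field_derivative_iff
  proof (rule LIM_zero_cancel, rule Lim_null_comparison [OF _ lim])
    have "norm ((unit_mellin_prim w z - unit_mellin_prim w s) / (z - s) - unit_mellin w s)
             \<le> K * I * norm (z - s)" if "Re z \<ge> 1" "z \<noteq> s" for z
    proof -
      have "(unit_mellin_prim w z - unit_mellin_prim w s) / (z - s) - unit_mellin w s =
            (unit_mellin_prim w z - unit_mellin_prim w s - unit_mellin w s * (z - s)) / (z - s)"
        using that by (simp add: field_simps)
      also have "norm \<dots> \<le> K * I * norm (z - s) ^ 2 / norm (z - s)"
        using bound [OF that(1)] by (simp add: norm_divide divide_right_mono)
      finally show ?thesis using that by (simp add: power2_eq_square)
    qed
    thus "\<forall>\<^sub>F z in at s within {s. 1 \<le> Re s}.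
            norm ((unit_mellin_prim w z - unit_mellin_prim w s) / (z - s) - unit_mellin w s)
              \<le> K * I * norm (z - s)"
      by (auto simp: eventually_at_filter)
  qed
qed

end

lemma integral_mellin_kernel_segment:
  assumes s: "Re s \<ge> 1" and \<alpha>: "0 \<le> \<alpha>" "\<alpha> \<le> 1"
  shows   "norm (LINT u:{\<alpha><..<1}|lborel. mellin_kernel s u) \<le> 2 / norm s"
          "\<alpha> = 0 \<Longrightarrow> (LINT u:{\<alpha><..<1}|lborel. mellin_kernel s u) = 1 / s"
proof -
  have s0: "s \<noteq> 0" using s by auto
  define G where "G = (\<lambda>u. if u = 0 then 0 else exp (of_real (ln u) * s) / s)"
  have normG: "norm (G u) \<le> u / norm s" if "u \<in> {0..1}" for u
  proof (cases "u = 0")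
    case False
    hence u: "0 < u" "u \<le> 1" using that by auto
    have "ln u * Re s \<le> ln u * 1"
      using u s by (intro mult_left_mono_neg) auto
    hence "exp (ln u * Re s) \<le> u"
      using u by (metis exp_le_cancel_iff exp_ln mult.right_neutral)
    thus ?thesis using u s0 by (simp add: G_def norm_divide divide_right_mono)
  qed (simp add: G_def)
  have derG: "(G has_vector_derivative mellin_kernel s u) (at u)" if "u > 0" for u
  proof -
    have "(((\<lambda>z. exp (z * s) / s) \<circ> (\<lambda>u. of_real (ln u))) has_vector_derivative
             of_real (1 / u) * exp (of_real (ln u) * s)) (at u)"
    proof (rule field_vector_diff_chain_at)
      show "((\<lambda>u. complex_of_real (ln u)) has_vector_derivative of_real (1 / u)) (at u)"
        using that
        by (intro has_vector_derivative_of_real)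
           (auto intro!: derivative_eq_intros simp: has_real_derivative_iff_has_vector_derivative [symmetric])
      show "((\<lambda>z. exp (z * s) / s) has_field_derivative exp (of_real (ln u) * s)) (at (of_real (ln u)))"
        using s0 by (auto intro!: derivative_eq_intros)
    qed
    also have "of_real (1 / u) * exp (of_real (ln u) * s) = mellin_kernel s u"
      using that s0 by (simp add: mellin_kernel_def algebra_simps exp_diff exp_of_real)
    finally have "((\<lambda>u. exp (of_real (ln u) * s) / s) has_vector_derivative mellin_kernel s u) (at u)"
      by (simp add: o_def)
    thus ?thesis
      by (rule has_vector_derivative_transform_within_open [of _ _ _ "{0<..}"])
         (use that in \<open>auto simp: G_def\<close>)
  qed
  have "continuous_on {0..1} G"
    unfolding continuous_on_eq_continuous_within
  proof
    fix u :: real assume u: "u \<in> {0..1}"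
    show "continuous (at u within {0..1}) G"
    proof (cases "u = 0")
      case True
      have "(G \<longlongrightarrow> 0) (at 0 within {0..1})"
      proof (rule Lim_null_comparison)
        show "\<forall>\<^sub>F u in at 0 within {0..1}. norm (G u) \<le> u / norm s"
          using normG by (auto simp: eventually_at_filter)
        have "((\<lambda>u::real. u / norm s) \<longlongrightarrow> 0 / norm s) (at 0 within {0..1})"
          using s0 by (intro tendsto_intros) auto
        thus "((\<lambda>u::real. u / norm s) \<longlongrightarrow> 0) (at 0 within {0..1})" by simp
      qed
      thus ?thesis using True by (simp add: continuous_within G_def)
    next
      case False
      hence "isCont G u"
        using derG [of u] u by (intro has_vector_derivative_continuous [of G]) auto
      thus ?thesis by (rule continuous_at_imp_continuous_within)
    qed
  qed
  hence "(mellin_kernel s has_integral (G 1 - G \<alpha>)) {\<alpha>..1}"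
    using \<alpha> by (intro fundamental_theorem_of_calculus_interior derG)
                (auto intro: continuous_on_subset)
  hence "integral {\<alpha><..<1} (mellin_kernel s) = G 1 - G \<alpha>"
    by (intro integral_unique) (simp add: has_integral_Icc_iff_Ioo)
  moreover have "set_integrable lborel {\<alpha><..<1} (mellin_kernel s)"
    by (rule set_integrable_bounded_open_interval [where B = 1])
       (use \<alpha> s in \<open>auto intro!: norm_mellin_kernel_le_1\<close>)
  ultimately have eq: "(LINT u:{\<alpha><..<1}|lborel. mellin_kernel s u) = G 1 - G \<alpha>"
    by (simp add: set_borel_integral_eq_integral)
  have "norm (G 1 - G \<alpha>) \<le> 1 / norm s + \<alpha> / norm s"
    using normG [of 1] normG [of \<alpha>] \<alpha> norm_triangle_ineq4 [of "G 1" "G \<alpha>"] by simp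
  also have "\<dots> \<le> 2 / norm s"
    using \<alpha> s0 by (simp add: field_simps)
  finally show "norm (LINT u:{\<alpha><..<1}|lborel. mellin_kernel s u) \<le> 2 / norm s"
    using eq by simp
  show "(LINT u:{\<alpha><..<1}|lborel. mellin_kernel s u) = 1 / s" if "\<alpha> = 0"
    using eq that by (simp add: G_def)
qed

interpretation one_weight: bounded_weight "\<lambda>_. 1" 1
  by standard auto

lemma unit_mellin_one: "Re s \<ge> 1 \<Longrightarrow> unit_mellin (\<lambda>_. 1) s = 1 / s"
  using integral_mellin_kernel_segment(2) [of s 0] by (simp add: unit_mellin_def)

text \<open>
  Frullani's integral for a complex parameter: both sides have the derivative \<open>1 / s\<close> and vanish
  at \<open>1\<close>.
\<close>

lemma unit_mellin_prim_one:
  assumes "Re s \<ge> 1"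
  shows   "unit_mellin_prim (\<lambda>_. 1) s = Ln s"
proof -
  have "\<exists>c. \<forall>x\<in>{s. Re s \<ge> 1}. unit_mellin_prim (\<lambda>_. 1) x - Ln x = c"
  proof (rule has_field_derivative_zero_constant [OF convex_halfplane_Re_ge1])
    fix z assume z: "z \<in> {s. Re s \<ge> 1}"
    hence "z \<notin> \<real>\<^sub>\<le>\<^sub>0" "z \<noteq> 0"
      by (auto simp: complex_nonpos_Reals_iff)
    thus "((\<lambda>x. unit_mellin_prim (\<lambda>_. 1) x - Ln x) has_field_derivative 0) (at z within {s. Re s \<ge> 1})"
      using z one_weight.prim_has_field_derivative [of z] unit_mellin_one [of z]
      by (auto intro!: derivative_eq_intros simp: inverse_eq_divide)
  qed
  then obtain c where c: "\<And>x. Re x \<ge> 1 \<Longrightarrow> unit_mellin_prim (\<lambda>_. 1) x - Ln x = c"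
    by auto
  have "c = 0"
    using c [of 1] one_weight.prim_at_1 by simp
  thus ?thesis using c [OF assms] by simp
qed

text \<open>
  By the layer-cake formula a monotone weight is a superposition of indicator functions of
  intervals \<open>{\<alpha><..<1}\<close>, each of which has a transform of size \<open>O(1 / \<bar>s\<bar>)\<close>. This takes the
  place of an integration by parts.
\<close>

lemma norm_unit_mellin_mono_on_le:
  assumes [measurable]: "f \<in> borel_measurable borel"
      and mono: "mono_on {0<..<1} f"
      and bounds: "\<And>u. u \<in> {0<..<1} \<Longrightarrow> 0 \<le> f u \<and> f u \<le> K"
      and s: "Re s \<ge> 1"
  shows   "norm (unit_mellin f s) \<le> 2 * K / norm s"
proof -
  have K: "K \<ge> 0" using bounds [of "1/2"] by auto
  define g where "g = (\<lambda>u v. (indicat_real {0<..<1} u * indicat_real {0<..<K} v * of_bool (v < f u)) *\<^sub>R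
                             mellin_kernel s u)"
  have g_meas [measurable]: "case_prod g \<in> borel_measurable (lborel \<Otimes>\<^sub>M lborel)"
    unfolding g_def by measurable
  have g_int: "integrable (lborel \<Otimes>\<^sub>M lborel) (case_prod g)"
  proof (rule integrableI_bounded_set [where A = "{0<..<1} \<times> {0<..<K}" and B = 1])
    show "emeasure (lborel \<Otimes>\<^sub>M lborel) ({0<..<1::real} \<times> {0<..<K}) < \<infinity>"
      using K by (subst lborel.emeasure_pair_measure_Times) (auto simp: ennreal_mult_less_top)
    show "AE x in lborel \<Otimes>\<^sub>M lborel. x \<in> {0<..<1} \<times> {0<..<K} \<longrightarrow> norm (case_prod g x) \<le> 1"
      using norm_mellin_kernel_le_1 [OF _ s] by (intro AE_I2) (auto simp: g_def)
    show "AE x in lborel \<Otimes>\<^sub>M lborel. x \<notin> {0<..<1} \<times> {0<..<K} \<longrightarrow> case_prod g x = 0"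
      by (intro AE_I2) (auto simp: g_def indicator_def split: if_splits)
  qed auto
  have inner_v: "(LINT v|lborel. g u v) = indicat_real {0<..<1} u *\<^sub>R (f u *\<^sub>R mellin_kernel s u)" for u
  proof (cases "u \<in> {0<..<1}")
    case True
    have "g u = (\<lambda>v. indicat_real {0<..<f u} v *\<^sub>R mellin_kernel s u)"
      using bounds [OF True] True by (auto simp: g_def indicator_def fun_eq_iff)
    thus ?thesis using True bounds [OF True] by simp
  qed (simp add: g_def)
  have inner_u: "norm (LINT u|lborel. g u v) \<le> indicat_real {0<..<K} v * (2 / norm s)" for v
  proof (cases "v \<in> {0<..<K}")
    case True
    \<comment> \<open>Inserting \<open>1\<close> makes the infimum meaningful when the superlevel set is empty.\<close>
    define S where "S = insert 1 {u \<in> {0<..<1}. v < f u}"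
    define \<alpha> where "\<alpha> = Inf S"
    have S: "S \<noteq> {}" "bdd_below S" "S \<subseteq> {0..1}"
      by (auto simp: S_def intro!: bdd_belowI [of _ 0])
    have \<alpha>: "0 \<le> \<alpha>" "\<alpha> \<le> 1"
    proof -
      show "0 \<le> \<alpha>"
        unfolding \<alpha>_def by (rule cInf_greatest [OF S(1)]) (use S(3) in auto)
      show "\<alpha> \<le> 1"
        unfolding \<alpha>_def by (rule cInf_lower [OF _ S(2)]) (simp add: S_def)
    qed
    have "g u v = indicat_real {\<alpha><..<1} u *\<^sub>R mellin_kernel s u" if "u \<noteq> \<alpha>" for u
    proof (cases "u \<in> {0<..<1}")
      case u: True
      have "v < f u \<longleftrightarrow> \<alpha> < u"
      proof
        assume "v < f u"
        hence "\<alpha> \<le> u" unfolding \<alpha>_def using S u by (intro cInf_lower) (auto simp: S_def)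
        thus "\<alpha> < u" using that by simp
      next
        assume "\<alpha> < u"
        then obtain t where t: "t \<in> S" "t < u"
          unfolding \<alpha>_def using S cInf_lessD by blast
        hence "t \<in> {0<..<1}" "v < f t" using u by (auto simp: S_def)
        moreover have "f t \<le> f u" using mono t u calculation by (auto intro: mono_onD)
        ultimately show "v < f u" by linarith
      qed
      thus ?thesis using True u by (simp add: g_def indicator_def)
    qed (use \<alpha> in \<open>auto simp: g_def indicator_def\<close>)
    hence "AE u in lborel. g u v = indicat_real {\<alpha><..<1} u *\<^sub>R mellin_kernel s u"
      using AE_lborel_singleton [of \<alpha>] by (auto elim: eventually_mono)
    moreover have "(\<lambda>u. g u v) \<in> borel_measurable lborel"
      unfolding g_def by measurable
    moreover have "(\<lambda>u. indicat_real {\<alpha><..<1} u *\<^sub>R mellin_kernel s u) \<in> borel_measurable lborel"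
      by measurable
    ultimately have "(LINT u|lborel. g u v) = (LINT u:{\<alpha><..<1}|lborel. mellin_kernel s u)"
      unfolding set_lebesgue_integral_def by (intro integral_cong_AE)
    thus ?thesis
      using integral_mellin_kernel_segment(1) [OF s \<alpha>] True by simp
  qed (simp add: g_def)
  have "unit_mellin f s = (LINT u|lborel. LINT v|lborel. g u v)"
    by (simp add: unit_mellin_def set_lebesgue_integral_def inner_v)
  also have "\<dots> = (LINT v|lborel. LINT u|lborel. g u v)"
    using lborel_pair.Fubini_integral [OF g_int] by simp
  also have "norm \<dots> \<le> (LINT v|lborel. indicat_real {0<..<K} v * (2 / norm s))"
    using K by (intro Bochner_Integration.integral_norm_bound_integral inner_u)
               (auto intro!: lborel_pair.integrable_snd [OF g_int] integrable_mult_left)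
  also have "\<dots> = 2 * K / norm s"
    using K by simp
  finally show ?thesis .
qed

lemma unit_mellin_diff:
  assumes "bounded_weight f K" "bounded_weight g L" "Re s \<ge> 1"
  shows   "unit_mellin (\<lambda>u. f u - g u) s = unit_mellin f s - unit_mellin g s"
  using set_integral_diff(2) [OF bounded_weight.integrable [OF assms(1,3)]
                                 bounded_weight.integrable [OF assms(2,3)]]
  by (simp add: unit_mellin_def scaleR_diff_left)

lemma norm_unit_mellin_antimono_on_le:
  assumes [measurable]: "f \<in> borel_measurable borel"
      and mono: "antimono_on {0<..<1} f"
      and bounds: "\<And>u. u \<in> {0<..<1} \<Longrightarrow> 0 \<le> f u \<and> f u \<le> K"
      and s: "Re s \<ge> 1"
  shows   "norm (unit_mellin f s) \<le> 3 * K / norm s"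
proof -
  have K: "K \<ge> 0" using bounds [of "1/2"] by auto
  have f: "bounded_weight f K"
    using bounds by unfold_locales auto
  have c: "bounded_weight (\<lambda>_. K) K"
    using K by unfold_locales auto
  have "unit_mellin (\<lambda>_. K) s = K / s"
    using unit_mellin_one [OF s] by (simp add: unit_mellin_def scaleR_conv_of_real)
  hence "unit_mellin f s = K / s - unit_mellin (\<lambda>u. K - f u) s"
    using unit_mellin_diff [OF c f s] by simp
  moreover have "norm (unit_mellin (\<lambda>u. K - f u) s) \<le> 2 * K / norm s"
    using bounds mono s by (intro norm_unit_mellin_mono_on_le) (auto simp: monotone_on_def)
  moreover have "norm (K / s) = K / norm s"
    using K by (simp add: norm_divide)
  ultimately have "norm (unit_mellin f s) \<le> K / norm s + 2 * K / norm s"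
    using norm_triangle_ineq4 [of "K / s" "unit_mellin (\<lambda>u. K - f u) s"] by simp
  thus ?thesis by (simp add: add_divide_distrib [symmetric])
qed

section \<open>The regularised kernel of the digamma function\<close>

text \<open>
  What remains of \<open>1 / (1 - exp (-x))\<close> after removal of its pole at \<open>0\<close>; it is monotone on the
  positive reals, with the limits \<open>1/2\<close> at \<open>0\<close> and \<open>1\<close> at infinity. The name refers to its power series
  \<open>\<Sum>n\<ge>1. B\<^sub>n x ^ (n - 1) / n!\<close> in the Bernoulli numbers with \<open>B\<^sub>1 = 1/2\<close>.
\<close>

definition bern :: "real \<Rightarrow> real" where
  "bern x = 1 / (1 - exp (-x)) - 1 / x"

definition exp_quot :: "real \<Rightarrow> real \<Rightarrow> real" where
  "exp_quot a x = (1 - exp (-a * x)) / x"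

lemma measurable_bern [measurable]: "bern \<in> borel_measurable borel"
  unfolding bern_def by measurable

lemma measurable_exp_quot [measurable]: "exp_quot a \<in> borel_measurable borel"
  unfolding exp_quot_def by measurable

lemma sinh_ge:
  assumes "(y::real) \<ge> 0"
  shows   "exp y - exp (-y) \<ge> 2 * y"
proof -
  have "(\<lambda>y. exp y - exp (-y) - 2 * y) 0 \<le> (\<lambda>y. exp y - exp (-y) - 2 * y) y"
  proof (rule DERIV_nonneg_imp_nondecreasing [OF assms])
    fix x :: real
    have "exp x + exp (-x) - 2 \<ge> 0"
    proof -
      have "exp x + exp (-x) - 2 = (exp (x/2) - exp (-x/2))\<^sup>2"
        by (simp add: power2_eq_square algebra_simps flip: exp_add)
      thus ?thesis by simp
    qed
    thus "\<exists>d. ((\<lambda>y. exp y - exp (-y) - 2 * y) has_real_derivative d) (at x) \<and> 0 \<le> d"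
      by (intro exI [of _ "exp x + exp (-x) - 2"]) (auto intro!: derivative_eq_intros)
  qed
  thus ?thesis by simp
qed

lemma bern_mono:
  assumes "0 < x" "x \<le> y"
  shows   "bern x \<le> bern y"
proof (rule DERIV_nonneg_imp_nondecreasing [OF assms(2)])
  fix t assume "x \<le> t" "t \<le> y"
  hence t: "t > 0" using assms by simp
  \<comment> \<open>The derivative is nonnegative because \<open>sinh (t / 2) \<ge> t / 2\<close>.\<close>
  have "t * exp (-t/2) \<le> (exp (t/2) - exp (-t/2)) * exp (-t/2)"
    using sinh_ge [of "t/2"] t by (intro mult_right_mono) auto
  also have "\<dots> = 1 - exp (-t)"
    by (simp add: algebra_simps flip: exp_add)
  finally have "(t * exp (-t/2))\<^sup>2 \<le> (1 - exp (-t))\<^sup>2"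
    using t by (intro power_mono) auto
  moreover have "(t * exp (-t/2))\<^sup>2 = t\<^sup>2 * exp (-t)"
    by (simp add: power_mult_distrib power2_eq_square flip: exp_add)
  moreover have "1 - exp (-t) > 0" using t by simp
  ultimately have "exp (-t) / (1 - exp (-t))\<^sup>2 \<le> 1 / t\<^sup>2"
    using t by (simp add: divide_simps mult_ac)
  moreover have "((\<lambda>x. inverse (1 - exp (-x)) - inverse x) has_real_derivative
                   1 / t\<^sup>2 - exp (-t) / (1 - exp (-t))\<^sup>2) (at t)"
  proof -
    have 1: "((\<lambda>x. 1 - exp (-x)) has_real_derivative exp (-t)) (at t)"
      by (auto intro!: derivative_eq_intros)
    have 2: "((\<lambda>x. inverse (1 - exp (-x))) has_real_derivative
               - (inverse (1 - exp (-t)) * exp (-t) * inverse (1 - exp (-t)))) (at t)"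
      using t by (intro DERIV_inverse' 1) auto
    have "- (inverse (1 - exp (-t)) * exp (-t) * inverse (1 - exp (-t))) - - (inverse t * inverse t) =
             1 / t\<^sup>2 - exp (-t) / (1 - exp (-t))\<^sup>2"
      by (simp add: power2_eq_square inverse_eq_divide)
    with DERIV_diff [OF 2 DERIV_inverse [of t UNIV]] t show ?thesis
      by (simp add: power2_eq_square)
  qed
  hence "(bern has_real_derivative 1 / t\<^sup>2 - exp (-t) / (1 - exp (-t))\<^sup>2) (at t)"
    by (simp add: bern_def [abs_def] inverse_eq_divide)
  ultimately show "\<exists>d. (bern has_real_derivative d) (at t) \<and> 0 \<le> d"
    by (intro exI [of _ "1 / t\<^sup>2 - exp (-t) / (1 - exp (-t))\<^sup>2"]) auto
qed

lemma bern_bounds: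
  assumes "x > 0"
  shows   "0 \<le> bern x" "bern x \<le> 1"
proof -
  have pos: "1 - exp (-x) > 0" using assms by simp
  have "1 - exp (-x) \<le> x" using exp_ge_add_one_self [of "-x"] by linarith
  thus "0 \<le> bern x" using pos assms by (simp add: bern_def frac_le)
  have "(1 + x) * exp (-x) \<le> exp x * exp (-x)"
    using exp_ge_add_one_self [of x] by (intro mult_right_mono) auto
  hence "x \<le> (1 + x) * (1 - exp (-x))"
    by (simp add: algebra_simps flip: exp_add)
  thus "bern x \<le> 1"
    using pos assms by (simp add: bern_def field_simps)
qed

lemma exp_quot_antimono:
  assumes "0 < x" "x \<le> y" "a \<ge> 0"
  shows   "exp_quot a y \<le> exp_quot a x"
proof (rule DERIV_nonpos_imp_nonincreasing [OF assms(2)])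
  fix t assume "x \<le> t" "t \<le> y"
  hence t: "t > 0" using assms by simp
  have "(1 + a * t) * exp (-a * t) \<le> exp (a * t) * exp (-a * t)"
    using exp_ge_add_one_self [of "a * t"] by (intro mult_right_mono) auto
  hence "a * t * exp (-a * t) - (1 - exp (-a * t)) \<le> 0"
    by (simp add: algebra_simps flip: exp_add)
  moreover have "(exp_quot a has_real_derivative (a * t * exp (-a * t) - (1 - exp (-a * t))) / t\<^sup>2) (at t)"
    unfolding exp_quot_def using t
    by (auto intro!: derivative_eq_intros simp: power2_eq_square)
  ultimately show "\<exists>d. (exp_quot a has_real_derivative d) (at t) \<and> d \<le> 0"
    by (intro exI [of _ "(a * t * exp (-a * t) - (1 - exp (-a * t))) / t\<^sup>2"])
       (auto simp: divide_nonpos_nonneg)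
qed

lemma exp_quot_bounds:
  assumes "x > 0" "a \<ge> 0"
  shows   "0 \<le> exp_quot a x" "exp_quot a x \<le> a"
proof -
  show "0 \<le> exp_quot a x" using assms by (simp add: exp_quot_def)
  have "1 - exp (-a * x) \<le> a * x" using exp_ge_add_one_self [of "-a * x"] by simp
  thus "exp_quot a x \<le> a" using assms by (simp add: exp_quot_def divide_simps)
qed

lemma bern_tendsto: "(bern \<longlongrightarrow> 1/2) (at_right 0)"
  unfolding bern_def by real_asymp

lemma exp_quot_tendsto: "(exp_quot a \<longlongrightarrow> a) (at_right 0)"
proof -
  have "((\<lambda>x. exp (-a * x)) has_real_derivative - a) (at 0)"
    by (auto intro!: derivative_eq_intros)
  hence "((\<lambda>x. (exp (-a * x) - 1) / x) \<longlongrightarrow> -a) (at 0)"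
    by (simp add: has_field_derivative_iff)
  hence "((\<lambda>x. - ((exp (-a * x) - 1) / x)) \<longlongrightarrow> - (-a)) (at 0)"
    by (rule tendsto_minus)
  moreover have "(\<lambda>x. - ((exp (-a * x) - 1) / x)) = exp_quot a"
    by (auto simp: exp_quot_def fun_eq_iff divide_simps)
  ultimately show ?thesis
    by (simp add: filterlim_at_split)
qed


text \<open>
  One summand of \<open>Q\<close> with its singularity at \<open>u = 1\<close> subtracted (note that \<open>ln u < 0\<close>). In the
  variable \<open>x = - ln u / A\<close> it is built from the two monotone functions above.
\<close>

definition reg_kernel :: "real \<Rightarrow> real \<Rightarrow> real \<Rightarrow> real" where
  "reg_kernel A a u = u powr (a / A) / (1 - u powr (1 / A)) + A / ln u"

lemma measurable_reg_kernel [measurable]: "reg_kernel A a \<in> borel_measurable borel"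
  unfolding reg_kernel_def by measurable

lemma reg_kernel_eq:
  assumes "A > 0" "u \<in> {0<..<1}"
  shows   "reg_kernel A a u = u powr (a / A) * bern (-ln u / A) - exp_quot a (-ln u / A)"
proof -
  have "exp (ln u / A) \<noteq> 1" using assms by simp
  thus ?thesis
    using assms
    by (simp add: reg_kernel_def bern_def exp_quot_def powr_def field_simps)
qed

lemma reg_kernel_bounded:
  assumes "A > 0" "a \<ge> 0" "u \<in> {0<..<1}"
  shows   "\<bar>reg_kernel A a u\<bar> \<le> 1 + a"
proof -
  define x where "x = -ln u / A"
  have x: "x > 0" using assms by (auto simp: x_def divide_neg_pos)
  have "0 \<le> u powr (a / A) * bern x \<and> u powr (a / A) * bern x \<le> 1"
    using bern_bounds [OF x] assms by (auto intro!: mult_le_one powr_le1)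
  thus ?thesis
    using exp_quot_bounds [OF x assms(2)] reg_kernel_eq [of A u a] assms by (auto simp: x_def)
qed

lemma bounded_weight_reg_kernel: "A > 0 \<Longrightarrow> a \<ge> 0 \<Longrightarrow> bounded_weight (reg_kernel A a) (1 + a)"
  by unfold_locales (auto intro!: reg_kernel_bounded)

lemma filterlim_neg_ln_at_left_1:
  assumes "A > 0"
  shows   "filterlim (\<lambda>u. -ln u / A) (at_right 0) (at_left (1::real))"
  unfolding filterlim_at
proof
  have "\<forall>\<^sub>F u in at_left (1::real). u \<in> {0<..<1}"
    by (rule eventually_at_leftI [of 0]) auto
  thus "\<forall>\<^sub>F u in at_left (1::real). -ln u / A \<in> {0<..} \<and> -ln u / A \<noteq> 0"
    by eventually_elim (use assms in \<open>auto simp: divide_neg_pos\<close>)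
  have "((\<lambda>u. -ln u / A) \<longlongrightarrow> -ln 1 / A) (at_left (1::real))"
    using assms by (intro tendsto_intros) auto
  thus "((\<lambda>u. -ln u / A) \<longlongrightarrow> 0) (at_left (1::real))" by simp
qed

lemma reg_kernel_tendsto:
  assumes "A > 0"
  shows   "(reg_kernel A a \<longlongrightarrow> 1/2 - a) (at_left 1)"
proof -
  have "((\<lambda>u. u powr (a / A) * bern (-ln u / A) - exp_quot a (-ln u / A))
           \<longlongrightarrow> 1 powr (a / A) * (1/2) - a) (at_left 1)"
    by (intro tendsto_intros filterlim_compose [OF bern_tendsto] filterlim_compose [OF exp_quot_tendsto]
          filterlim_neg_ln_at_left_1 assms) auto
  moreover have "\<forall>\<^sub>F u in at_left 1. u powr (a / A) * bern (-ln u / A) - exp_quot a (-ln u / A) =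
                    reg_kernel A a u"
    using assms by (intro eventually_at_leftI [of 0]) (auto simp: reg_kernel_eq)
  ultimately show ?thesis
    by (auto dest: Lim_transform_eventually)
qed

lemma unit_mellin_powr:
  assumes "r \<ge> 0"
  shows   "unit_mellin (\<lambda>u. u powr r * f u) s = unit_mellin f (s + of_real r)"
  unfolding unit_mellin_def
  by (rule set_lebesgue_integral_cong) (auto simp: mellin_kernel_add_real)

text \<open>
  The two monotone pieces of the regularised kernel each have a transform of size
  \<open>O(1 / \<bar>s\<bar>)\<close>; the factor \<open>u powr (a / A)\<close>, which spoils monotonicity, only shifts \<open>s\<close> to the right.
\<close>

lemma norm_unit_mellin_reg_kernel_le:
  assumes "A > 0" "a \<ge> 0" "Re s \<ge> 1"
  shows   "norm (unit_mellin (reg_kernel A a) s) \<le> (3 + 2 * a) / norm s"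
proof -
  define f where "f = (\<lambda>u. bern (-ln u / A))"
  define g where "g = (\<lambda>u. exp_quot a (-ln u / A))"
  have x: "-ln u / A > 0" if "u \<in> {0<..<1}" for u
    using that assms by (auto simp: divide_neg_pos)
  have [measurable]: "f \<in> borel_measurable borel" "g \<in> borel_measurable borel"
    unfolding f_def g_def
    by (intro measurable_compose [OF _ measurable_bern] measurable_compose [OF _ measurable_exp_quot]; measurable)+
  have f_bounds: "0 \<le> f u \<and> f u \<le> 1" if "u \<in> {0<..<1}" for u
    using bern_bounds [OF x [OF that]] by (simp add: f_def)
  have g_bounds: "0 \<le> g u \<and> g u \<le> a" if "u \<in> {0<..<1}" for u
    using exp_quot_bounds [OF x [OF that] assms(2)] by (simp add: g_def)
  have f1: "bounded_weight (\<lambda>u. u powr (a / A) * f u) 1"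
  proof
    fix u :: real assume u: "u \<in> {0<..<1}"
    have "u powr (a / A) * f u \<le> 1"
      using f_bounds [OF u] assms u by (intro mult_le_one powr_le1) auto
    thus "\<bar>u powr (a / A) * f u\<bar> \<le> 1"
      using f_bounds [OF u] by (simp add: abs_mult)
  qed simp
  have g1: "bounded_weight g a"
    by unfold_locales (use g_bounds in auto)
  have "unit_mellin (reg_kernel A a) s = unit_mellin (\<lambda>u. u powr (a / A) * f u - g u) s"
    unfolding unit_mellin_def
    by (rule set_lebesgue_integral_cong) (use assms in \<open>auto simp: reg_kernel_eq f_def g_def\<close>)
  also have "\<dots> = unit_mellin f (s + of_real (a / A)) - unit_mellin g s"
    using unit_mellin_diff [OF f1 g1 assms(3)] unit_mellin_powr [of "a / A" f s] assms by simp
  finally have eq: "unit_mellin (reg_kernel A a) s = \<dots>" .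
  have "antimono_on {0<..<1} f"
    unfolding f_def using x assms by (auto simp: monotone_on_def intro!: bern_mono divide_right_mono)
  hence "norm (unit_mellin f (s + of_real (a / A))) \<le> 3 * 1 / norm (s + of_real (a / A))"
    using assms f_bounds by (intro norm_unit_mellin_antimono_on_le) (auto intro: add_increasing2)
  also have "\<dots> \<le> 3 / norm s"
  proof -
    have "norm s \<le> norm (s + of_real (a / A))"
      using assms by (auto simp: cmod_def intro!: real_sqrt_le_mono power_mono add_right_mono)
    moreover have "norm s > 0" using assms by auto
    ultimately show ?thesis by (simp add: frac_le)
  qed
  finally have "norm (unit_mellin f (s + of_real (a / A))) \<le> 3 / norm s" .
  moreover have "mono_on {0<..<1} g"
    unfolding g_def using x assms by (auto simp: monotone_on_def intro!: exp_quot_antimono divide_right_mono)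
  hence "norm (unit_mellin g s) \<le> 2 * a / norm s"
    using g_bounds assms by (intro norm_unit_mellin_mono_on_le) auto
  ultimately have "norm (unit_mellin (reg_kernel A a) s) \<le> 3 / norm s + 2 * a / norm s"
    unfolding eq using norm_triangle_ineq4 [of "unit_mellin f (s + of_real (a / A))" "unit_mellin g s"]
    by linarith
  thus ?thesis by (simp add: add_divide_distrib)
qed

text \<open>
  Multiplying the regularised kernel by \<open>1 - u powr (1 / A)\<close> clears its denominator, so that the
  difference of its transform at \<open>s\<close> and at \<open>s + 1 / A\<close> is elementary.
\<close>

lemma unit_mellin_reg_kernel_step:
  assumes A: "A > 0" and a: "a \<ge> 0" and s: "Re s \<ge> 1"
  shows   "unit_mellin (reg_kernel A a) s - unit_mellin (reg_kernel A a) (s + of_real (1 / A)) =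
             1 / (s + of_real (a / A)) - A * (Ln (s + of_real (1 / A)) - Ln s)"
proof -
  let ?s = "s + of_real (1 / A)"
  have s': "Re ?s \<ge> 1" "Re (s + of_real (a / A)) \<ge> 1"
    using assms by (auto intro: add_increasing2)
  interpret bounded_weight "reg_kernel A a" "1 + a"
    using assms by (intro bounded_weight_reg_kernel)
  have int1: "set_integrable lborel {0<..<1} (\<lambda>u. mellin_kernel (s + of_real (a / A)) u)"
    using one_weight.integrable [OF s'(2)] by simp
  note int2 = set_integral_diff [OF one_weight.prim_integrable [OF s'(1)] one_weight.prim_integrable [OF s]]
  have "unit_mellin (reg_kernel A a) s - unit_mellin (reg_kernel A a) ?s =
          (LINT u:{0<..<1}|lborel. reg_kernel A a u *\<^sub>R mellin_kernel s u - reg_kernel A a u *\<^sub>R mellin_kernel ?s u)"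
    unfolding unit_mellin_def by (rule set_integral_diff(2) [symmetric]) (use s s' in \<open>auto intro: integrable\<close>)
  also have "\<dots> = (LINT u:{0<..<1}|lborel. mellin_kernel (s + of_real (a / A)) u -
                     of_real A * ((1 / ln u) *\<^sub>R (mellin_kernel ?s u - 1) - (1 / ln u) *\<^sub>R (mellin_kernel s u - 1)))"
  proof (rule set_lebesgue_integral_cong, simp, intro allI impI)
    fix u :: real assume u: "u \<in> {0<..<1}"
    define t where "t = u powr (1 / A)"
    have t: "t \<noteq> 1"
    proof -
      have "exp (ln u / A) < 1" using u A by (auto simp: divide_neg_pos)
      thus ?thesis using u A by (simp add: t_def powr_def)
    qed
    have "reg_kernel A a u * (1 - t) = u powr (a / A) + A / ln u * (1 - t)"
      using t unfolding reg_kernel_def t_def [symmetric] by (simp add: field_simps)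
    hence "complex_of_real (reg_kernel A a u * (1 - t)) = of_real (u powr (a / A) + A / ln u * (1 - t))"
      by (simp only:)
    hence "of_real (reg_kernel A a u) * (1 - of_real t) =
             complex_of_real (u powr (a / A)) + of_real (A / ln u) * (1 - of_real t)"
      by (simp only: of_real_mult of_real_add of_real_diff of_real_1)
    hence "(of_real (reg_kernel A a u) * (1 - of_real t)) * mellin_kernel s u =
             (complex_of_real (u powr (a / A)) + of_real (A / ln u) * (1 - of_real t)) * mellin_kernel s u"
      by simp
    hence "of_real (reg_kernel A a u) * mellin_kernel s u - of_real (reg_kernel A a u) * (of_real t * mellin_kernel s u) =
             of_real (u powr (a / A)) * mellin_kernel s u -
               (of_real (A / ln u) * (of_real t * mellin_kernel s u - 1) -
                of_real (A / ln u) * (mellin_kernel s u - 1))"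
      by algebra
    moreover have "mellin_kernel ?s u = of_real t * mellin_kernel s u"
      and "mellin_kernel (s + of_real (a / A)) u = of_real (u powr (a / A)) * mellin_kernel s u"
      using u by (simp_all only: mellin_kernel_add_real t_def scaleR_conv_of_real greaterThanLessThan_iff)
    moreover have "complex_of_real (A / ln u) * z = of_real A * ((1 / ln u) *\<^sub>R z)" for z
      by (simp add: scaleR_conv_of_real)
    ultimately show "reg_kernel A a u *\<^sub>R mellin_kernel s u - reg_kernel A a u *\<^sub>R mellin_kernel ?s u =
            mellin_kernel (s + of_real (a / A)) u -
              of_real A * ((1 / ln u) *\<^sub>R (mellin_kernel ?s u - 1) - (1 / ln u) *\<^sub>R (mellin_kernel s u - 1))"
      by (simp only: scaleR_conv_of_real [of "reg_kernel A a u"] right_diff_distrib [of "complex_of_real A"])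
  qed
  also have "\<dots> = 1 / (s + of_real (a / A)) -
                    of_real A * (unit_mellin_prim (\<lambda>_. 1) ?s - unit_mellin_prim (\<lambda>_. 1) s)"
    using set_integral_diff(2) [OF int1 set_integrable_mult_right [OF int2(1), of "of_real A"]] int2(2)
          unit_mellin_one [OF s'(2)]
    by (simp add: unit_mellin_def unit_mellin_prim_def set_integral_mult_right)
  finally show ?thesis
    using unit_mellin_prim_one [OF s] unit_mellin_prim_one [OF s'(1)] by simp
qed

text \<open>
  Telescoping the previous step turns \<open>unit_mellin (reg_kernel A a)\<close> into the series of the
  digamma function; this is Binet's integral in multiplicative form.
\<close>

theorem Digamma_conv_unit_mellin:
  assumes A: "A > 0" and a: "a \<ge> 0" and s: "Re s \<ge> 1"
  shows   "of_real A * Digamma (of_real A * s + of_real a) =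
             of_real (A * ln A) + of_real A * Ln s - unit_mellin (reg_kernel A a) s"
proof -
  define \<Phi> where "\<Phi> = unit_mellin (reg_kernel A a)"
  define z where "z = of_real A * s + of_real a"
  define h where "h = (\<lambda>m::nat. of_real (real m / A) :: complex)"
  have h: "Re (s + h m) \<ge> 1 + real m / A" for m
    using s A by (simp add: h_def)
  have Re_h: "Re (s + h m) \<ge> 1" for m
    using A s by (auto simp: h_def intro: add_increasing2)
  have "Re z > 0" using assms by (simp add: z_def add_pos_nonneg)
  hence z: "z \<noteq> 0" "\<And>n. z + of_nat n \<noteq> 0"
    by (auto simp: complex_eq_iff)
  have h_Suc: "s + h (Suc m) = (s + h m) + of_real (1 / A)" for m
    by (simp add: h_def add_divide_distrib algebra_simps)
  have h_a: "1 / (s + h m + of_real (a / A)) = of_real A * inverse (z + of_nat m)" for m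
    using A z(2) [of m] by (simp add: h_def z_def field_simps)
  have telescope: "\<Phi> s - \<Phi> (s + h m) =
          of_real A * (\<Sum>n<m. inverse (z + of_nat n)) - of_real A * (Ln (s + h m) - Ln s)" for m
  proof (induction m)
    case 0
    show ?case by (simp add: h_def)
  next
    case (Suc m)
    have step: "\<Phi> (s + h m) - \<Phi> (s + h (Suc m)) =
             of_real A * inverse (z + of_nat m) - of_real A * (Ln (s + h (Suc m)) - Ln (s + h m))"
      unfolding \<Phi>_def h_Suc unit_mellin_reg_kernel_step [OF A a Re_h] h_a ..
    have "\<Phi> s - \<Phi> (s + h (Suc m)) = (\<Phi> s - \<Phi> (s + h m)) + (\<Phi> (s + h m) - \<Phi> (s + h (Suc m)))"
      by simp
    thus ?case unfolding Suc step by (simp add: algebra_simps)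
  qed
  have lim1: "(\<lambda>m. \<Phi> (s + h m)) \<longlonglongrightarrow> 0"
  proof (rule Lim_null_comparison)
    show "\<forall>\<^sub>F m in sequentially. norm (\<Phi> (s + h m)) \<le> (3 + 2 * a) / (1 + real m / A)"
    proof (intro always_eventually allI)
      fix m
      have "norm (\<Phi> (s + h m)) \<le> (3 + 2 * a) / norm (s + h m)"
        unfolding \<Phi>_def by (rule norm_unit_mellin_reg_kernel_le [OF A a Re_h])
      also have "\<dots> \<le> (3 + 2 * a) / (1 + real m / A)"
        using order_trans [OF h complex_Re_le_cmod, of m] A a
        by (intro frac_le) (auto intro: add_pos_nonneg)
      finally show "norm (\<Phi> (s + h m)) \<le> (3 + 2 * a) / (1 + real m / A)" .
    qed
    show "(\<lambda>m. (3 + 2 * a) / (1 + real m / A)) \<longlonglongrightarrow> 0"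
      using A by real_asymp
  qed
  have lim2: "(\<lambda>m. Ln (s + h m) - of_real (ln (real m))) \<longlonglongrightarrow> - of_real (ln A)"
  proof -
    have "(\<lambda>m. A / real m) \<longlonglongrightarrow> 0" by real_asymp
    hence "(\<lambda>m. 1 + s * of_real (A / real m)) \<longlonglongrightarrow> 1 + s * of_real 0"
      by (intro tendsto_add tendsto_mult tendsto_const tendsto_of_real)
    hence "(\<lambda>m. 1 + s * of_real (A / real m)) \<longlonglongrightarrow> 1" by simp
    hence "(\<lambda>m. Ln (1 + s * of_real (A / real m)) - of_real (ln A)) \<longlonglongrightarrow> Ln 1 - of_real (ln A)"
      by (intro tendsto_diff tendsto_Ln tendsto_const) (auto simp: complex_nonpos_Reals_iff)
    hence "(\<lambda>m. Ln (1 + s * of_real (A / real m)) - of_real (ln A)) \<longlonglongrightarrow> - of_real (ln A)"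
      by simp
    moreover have "\<forall>\<^sub>F m in sequentially. Ln (1 + s * of_real (A / real m)) - of_real (ln A) =
                      Ln (s + h m) - of_real (ln (real m))"
      using eventually_gt_at_top [of 0]
    proof eventually_elim
      case (elim m)
      have "Re (1 + s * of_real (A / real m)) > 0"
        using A s elim by (simp add: add_pos_nonneg)
      hence nz: "1 + s * of_real (A / real m) \<noteq> 0"
        by (metis less_irrefl zero_complex.sel(1))
      have "s + h m = of_real (real m / A) * (1 + s * of_real (A / real m))"
        using A elim by (simp add: h_def field_simps)
      hence "Ln (s + h m) = of_real (ln (real m / A)) + Ln (1 + s * of_real (A / real m))"
        using Ln_times_of_real [of "real m / A" "1 + s * of_real (A / real m)"]
              Ln_of_real [of "real m / A"] A elim nz by simp
      thus ?case using A elim by (simp add: ln_div)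
    qed
    ultimately show ?thesis by (auto dest: Lim_transform_eventually)
  qed
  define X where "X = (\<lambda>m. of_real A * (of_real (ln (real m)) - (\<Sum>n<m. inverse (z + of_nat n))))"
  have "X \<longlonglongrightarrow> of_real A * Digamma z"
    unfolding X_def by (intro tendsto_intros Digamma_LIMSEQ z)
  moreover have "X = (\<lambda>m. of_real A * Ln s - of_real A * (Ln (s + h m) - of_real (ln (real m))) - \<Phi> s + \<Phi> (s + h m))"
  proof
    fix m
    show "X m = of_real A * Ln s - of_real A * (Ln (s + h m) - of_real (ln (real m))) - \<Phi> s + \<Phi> (s + h m)"
      using telescope [of m] by (simp add: X_def algebra_simps)
  qed
  moreover have "(\<lambda>m. of_real A * Ln s - of_real A * (Ln (s + h m) - of_real (ln (real m))) - \<Phi> s + \<Phi> (s + h m))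
                   \<longlonglongrightarrow> of_real A * Ln s - of_real A * (- of_real (ln A)) - \<Phi> s + 0"
    by (intro tendsto_intros lim1 lim2)
  ultimately have "of_real A * Digamma z = of_real A * Ln s - of_real A * (- of_real (ln A)) - \<Phi> s + 0"
    by (simp add: LIMSEQ_unique)
  thus ?thesis by (simp add: \<Phi>_def z_def)
qed

section \<open>The quotient of gamma functions in the half-plane \<open>Re s \<ge> 1\<close>\<close>

lemma unit_mellin_prim_diff:
  assumes "bounded_weight f K" "bounded_weight g L" "Re s \<ge> 1"
  shows   "unit_mellin_prim (\<lambda>u. f u - g u) s = unit_mellin_prim f s - unit_mellin_prim g s"
  using set_integral_diff(2) [OF bounded_weight.prim_integrable [OF assms(1,3)]
                                 bounded_weight.prim_integrable [OF assms(2,3)]]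
  by (simp add: unit_mellin_prim_def scaleR_diff_left diff_divide_distrib)

lemma unit_mellin_sum:
  assumes "\<And>i. i \<in> I \<Longrightarrow> bounded_weight (f i) (K i)" "Re s \<ge> 1" "finite I"
  shows   "unit_mellin (\<lambda>u. \<Sum>i\<in>I. f i u) s = (\<Sum>i\<in>I. unit_mellin (f i) s)"
  unfolding unit_mellin_def set_lebesgue_integral_def scaleR_sum_left scaleR_sum_right
  using bounded_weight.integrable [OF assms(1,2)]
  by (intro Bochner_Integration.integral_sum) (auto simp: set_integrable_def)

lemma bounded_weight_sum:
  assumes "\<And>i. i \<in> I \<Longrightarrow> bounded_weight (f i) (K i)"
  shows   "bounded_weight (\<lambda>u. \<Sum>i\<in>I. f i u) (\<Sum>i\<in>I. K i)"
proof
  show "(\<lambda>u. \<Sum>i\<in>I. f i u) \<in> borel_measurable borel"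
    using assms by (intro borel_measurable_sum) (auto dest: bounded_weight.measurable_weight)
  show "\<bar>\<Sum>i\<in>I. f i u\<bar> \<le> (\<Sum>i\<in>I. K i)" if "u \<in> {0<..<1}" for u
    by (intro order_trans [OF sum_abs] sum_mono bounded_weight.weight_le [OF assms that])
qed

lemma bounded_weight_diff:
  assumes "bounded_weight f K" "bounded_weight g L"
  shows   "bounded_weight (\<lambda>u. f u - g u) (K + L)"
proof
  show "(\<lambda>u. f u - g u) \<in> borel_measurable borel"
    using assms by (intro borel_measurable_diff) (auto dest: bounded_weight.measurable_weight)
  show "\<bar>f u - g u\<bar> \<le> K + L" if "u \<in> {0<..<1}" for u
    using bounded_weight.weight_le [OF assms(1) that] bounded_weight.weight_le [OF assms(2) that]
    by linarith
qed

text \<open>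
  The real part of \<open>(u powr (s - 1) - 1) / ln u\<close> is nonnegative, so a weight that is nonnegative near
  \<open>1\<close> has a primitive whose real part is bounded below in the whole half-plane.
\<close>

lemma (in bounded_weight) Re_prim_ge:
  assumes nonneg: "\<And>u. u \<in> {u\<^sub>1<..<1} \<Longrightarrow> w u \<ge> 0" and u1: "0 < u\<^sub>1" "u\<^sub>1 < 1" and s: "Re s \<ge> 1"
  shows   "Re (unit_mellin_prim w s) \<ge> 2 * K / ln u\<^sub>1"
proof -
  let ?f = "\<lambda>u. (w u / ln u) *\<^sub>R (mellin_kernel s u - 1)"
  have le: "2 * K / ln u\<^sub>1 \<le> Re (?f u)" if u: "u \<in> {0<..<1}" for u
  proof -
    define d where "d = 1 - Re (mellin_kernel s u)"
    have "Re (mellin_kernel s u) \<le> 1" "Re (mellin_kernel s u) \<ge> -1"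
      using norm_mellin_kernel_le_1 [OF u s] abs_Re_le_cmod [of "mellin_kernel s u"] by auto
    hence d: "0 \<le> d" "d \<le> 2" by (auto simp: d_def)
    have eq: "Re (?f u) = w u * (d / (-ln u))" by (simp add: d_def diff_divide_distrib right_diff_distrib)
    show ?thesis
    proof (cases "u > u\<^sub>1")
      case True
      hence "Re (?f u) \<ge> 0" unfolding eq using nonneg [of u] u d by (intro mult_nonneg_nonneg divide_nonneg_nonneg) auto
      moreover have "2 * K / ln u\<^sub>1 \<le> 0" using u1 K_nonneg by (simp add: divide_nonneg_neg)
      ultimately show ?thesis by linarith
    next
      case False
      hence ln: "ln u \<le> ln u\<^sub>1" "ln u\<^sub>1 < 0" using u u1 by auto
      have "d / (-ln u) \<le> 2 / (- ln u\<^sub>1)"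
        using ln d by (intro frac_le) auto
      hence "\<bar>w u\<bar> * (d / (-ln u)) \<le> K * (2 / (- ln u\<^sub>1))"
        using weight_le [OF u] K_nonneg ln d by (intro mult_mono divide_nonneg_nonneg) auto
      moreover have "- \<bar>w u\<bar> * (d / (-ln u)) \<le> w u * (d / (-ln u))"
        using ln d by (intro mult_right_mono divide_nonneg_nonneg) auto
      moreover have "2 * K / ln u\<^sub>1 = - (K * (2 / (- ln u\<^sub>1)))"
        by simp
      ultimately show ?thesis unfolding eq by linarith
    qed
  qed
  have int: "set_integrable lborel {0<..<1} ?f" by (rule prim_integrable [OF s])
  have Re_int: "set_integrable lborel {0<..<1} (\<lambda>u. Re (?f u))"
    using integrable_Re [OF int [unfolded set_integrable_def]]
    by (simp add: set_integrable_def mult.assoc)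
  have "2 * K / ln u\<^sub>1 = (LINT u:{0<..<1::real}|lborel. 2 * K / ln u\<^sub>1)"
    by (simp add: set_lebesgue_integral_def)
  also have "\<dots> \<le> (LINT u:{0<..<1}|lborel. Re (?f u))"
    by (rule set_integral_mono [OF _ Re_int le])
       (auto intro!: set_integrable_bounded_open_interval [where B = "\<bar>2 * K / ln u\<^sub>1\<bar>"])
  also have "\<dots> = Re (unit_mellin_prim w s)"
    using integral_Re [OF int [unfolded set_integrable_def]]
    by (simp add: unit_mellin_prim_def set_lebesgue_integral_def mult.assoc)
  finally show ?thesis .
qed

locale fox_params =
  fixes p q :: nat and A a B b :: "nat \<Rightarrow> real"
  assumes p_pos: "p \<ge> 1"
      and A_pos: "\<And>i. i \<in> {1..p} \<Longrightarrow> A i > 0" and B_pos: "\<And>j. j \<in> {1..q} \<Longrightarrow> B j > 0"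
      and a_nonneg: "\<And>i. i \<in> {1..p} \<Longrightarrow> a i \<ge> 0" and b_nonneg: "\<And>j. j \<in> {1..q} \<Longrightarrow> b j \<ge> 0"
      and mu_pos: "fox_mu p q a b > 0"
      and balanced: "(\<Sum>i=1..p. A i) = (\<Sum>j=1..q. B j)"
begin

definition M :: "complex \<Rightarrow> complex" where
  "M s = (\<Prod>k=1..p. Gamma (of_real (A k) * s + of_real (a k))) /
         (\<Prod>j=1..q. Gamma (of_real (B j) * s + of_real (b j)))"

abbreviation (input) Q :: "real \<Rightarrow> real" where "Q \<equiv> fox_Q p q A a B b"

definition F :: "complex \<Rightarrow> complex" where "F = unit_mellin (fox_Q p q A a B b)"

definition \<rho> :: real where "\<rho> = fox_rho p q A B"

definition Q_bound :: real where "Q_bound = (\<Sum>i=1..p. 1 + a i) + (\<Sum>j=1..q. 1 + b j)"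

definition F_bound :: real where "F_bound = (\<Sum>i=1..p. 3 + 2 * a i) + (\<Sum>j=1..q. 3 + 2 * b j)"

text \<open>
  A branch of the logarithm of \<open>M\<close>, with derivative \<open>D\<close>.
\<close>

definition ln_M :: "complex \<Rightarrow> complex" where
  "ln_M s = (\<Sum>k=1..p. ln_Gamma (of_real (A k) * s + of_real (a k))) -
            (\<Sum>j=1..q. ln_Gamma (of_real (B j) * s + of_real (b j)))"

definition D :: "complex \<Rightarrow> complex" where
  "D s = (\<Sum>k=1..p. of_real (A k) * Digamma (of_real (A k) * s + of_real (a k))) -
         (\<Sum>j=1..q. of_real (B j) * Digamma (of_real (B j) * s + of_real (b j)))"

text \<open>The singularities \<open>A i / ln u\<close> and \<open>B j / ln u\<close> cancel because the two sums agree.\<close>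

lemma Q_eq: "Q u = (\<Sum>i=1..p. reg_kernel (A i) (a i) u) - (\<Sum>j=1..q. reg_kernel (B j) (b j) u)"
  by (simp add: fox_Q_def reg_kernel_def sum.distrib balanced flip: sum_divide_distrib del: One_nat_def)

lemma bounded_weight_Q: "bounded_weight Q Q_bound"
  unfolding Q_eq [abs_def] Q_bound_def
  using A_pos B_pos a_nonneg b_nonneg
  by (intro bounded_weight_diff bounded_weight_sum bounded_weight_reg_kernel) auto

lemma Q_tendsto_mu: "(Q \<longlongrightarrow> fox_mu p q a b) (at_left 1)"
proof -
  have "(Q \<longlongrightarrow> (\<Sum>i=1..p. 1/2 - a i) - (\<Sum>j=1..q. 1/2 - b j)) (at_left 1)"
    unfolding Q_eq [abs_def] using A_pos B_pos by (intro tendsto_intros reg_kernel_tendsto) auto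
  also have "(\<Sum>i=1..p. 1/2 - a i) - (\<Sum>j=1..q. 1/2 - b j) = fox_mu p q a b"
    by (simp add: fox_mu_def sum_subtractf diff_divide_distrib)
  finally show ?thesis .
qed

lemma A_nz: "i \<in> {1..p} \<Longrightarrow> A i \<noteq> 0" and B_nz: "j \<in> {1..q} \<Longrightarrow> B j \<noteq> 0"
  using A_pos B_pos by (metis less_irrefl)+

lemma rho_factors_pos: "(\<Prod>i=1..p. A i powr A i) > 0" "(\<Prod>j=1..q. B j powr (- B j)) > 0"
  using A_nz B_nz by (auto intro!: prod_pos simp del: One_nat_def atLeastAtMost_iff)

lemma rho_pos: "\<rho> > 0"
  unfolding \<rho>_def fox_rho_def by (intro mult_pos_pos rho_factors_pos)

lemma ln_rho: "ln \<rho> = (\<Sum>i=1..p. A i * ln (A i)) - (\<Sum>j=1..q. B j * ln (B j))"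
proof -
  have "ln \<rho> = (\<Sum>i=1..p. ln (A i powr A i)) + (\<Sum>j=1..q. ln (B j powr (- B j)))"
    unfolding \<rho>_def fox_rho_def ln_mult_pos [OF rho_factors_pos]
    using A_nz B_nz by (intro arg_cong2 [of _ _ _ _ "(+)"] ln_prod) (auto simp del: One_nat_def atLeastAtMost_iff)
  also have "\<dots> = (\<Sum>i=1..p. A i * ln (A i)) + (\<Sum>j=1..q. - (B j * ln (B j)))"
    using A_pos B_pos by (intro arg_cong2 [of _ _ _ _ "(+)"] sum.cong) (auto simp: ln_powr)
  finally show ?thesis by (simp add: sum_negf)
qed

lemma F_eq:
  assumes "Re s \<ge> 1"
  shows   "F s = (\<Sum>i=1..p. unit_mellin (reg_kernel (A i) (a i)) s) -
                 (\<Sum>j=1..q. unit_mellin (reg_kernel (B j) (b j)) s)"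
proof -
  have bw: "bounded_weight (reg_kernel (A i) (a i)) (1 + a i)" if "i \<in> {1..p}" for i
    using that A_pos a_nonneg by (intro bounded_weight_reg_kernel) auto
  have bw': "bounded_weight (reg_kernel (B i) (b i)) (1 + b i)" if "i \<in> {1..q}" for i
    using that B_pos b_nonneg by (intro bounded_weight_reg_kernel) auto
  have "F s = unit_mellin (\<lambda>u. \<Sum>i=1..p. reg_kernel (A i) (a i) u) s -
              unit_mellin (\<lambda>u. \<Sum>j=1..q. reg_kernel (B j) (b j) u) s"
    unfolding F_def Q_eq [abs_def]
    by (rule unit_mellin_diff [OF bounded_weight_sum bounded_weight_sum assms]) (fact bw bw')+
  also have "unit_mellin (\<lambda>u. \<Sum>i=1..p. reg_kernel (A i) (a i) u) s =
               (\<Sum>i=1..p. unit_mellin (reg_kernel (A i) (a i)) s)"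
    by (rule unit_mellin_sum [OF bw assms]) auto
  also have "unit_mellin (\<lambda>u. \<Sum>j=1..q. reg_kernel (B j) (b j) u) s =
               (\<Sum>j=1..q. unit_mellin (reg_kernel (B j) (b j)) s)"
    by (rule unit_mellin_sum [OF bw' assms]) auto
  finally show ?thesis .
qed

lemma D_eq:
  assumes "Re s \<ge> 1"
  shows   "D s = of_real (ln \<rho>) - F s"
proof -
  have "D s = (\<Sum>i=1..p. of_real (A i * ln (A i)) + of_real (A i) * Ln s - unit_mellin (reg_kernel (A i) (a i)) s) -
              (\<Sum>j=1..q. of_real (B j * ln (B j)) + of_real (B j) * Ln s - unit_mellin (reg_kernel (B j) (b j)) s)"
    unfolding D_def using assms A_pos B_pos a_nonneg b_nonneg
    by (intro arg_cong2 [of _ _ _ _ "(-)"] sum.cong Digamma_conv_unit_mellin) auto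
  also have "\<dots> = of_real ((\<Sum>i=1..p. A i * ln (A i)) - (\<Sum>j=1..q. B j * ln (B j))) +
                    of_real ((\<Sum>i=1..p. A i) - (\<Sum>j=1..q. B j)) * Ln s - F s"
    by (simp add: F_eq [OF assms] sum.distrib sum_subtractf sum_distrib_right left_diff_distrib)
  finally show ?thesis by (simp add: balanced ln_rho del: One_nat_def)
qed

lemma norm_F_le:
  assumes "Re s \<ge> 1"
  shows   "norm (F s) \<le> F_bound / norm s"
proof -
  have "norm (F s) \<le> (\<Sum>i=1..p. norm (unit_mellin (reg_kernel (A i) (a i)) s)) +
                     (\<Sum>j=1..q. norm (unit_mellin (reg_kernel (B j) (b j)) s))"
    unfolding F_eq [OF assms] by (intro norm_triangle_le_diff add_mono norm_sum)
  also have "\<dots> \<le> (\<Sum>i=1..p. (3 + 2 * a i) / norm s) + (\<Sum>j=1..q. (3 + 2 * b j) / norm s)"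
    using assms A_pos B_pos a_nonneg b_nonneg
    by (intro add_mono sum_mono norm_unit_mellin_reg_kernel_le) auto
  also have "\<dots> = F_bound / norm s"
    by (simp add: F_bound_def add_divide_distrib sum_divide_distrib)
  finally show ?thesis .
qed

lemma F_bound_nonneg: "F_bound \<ge> 0"
  unfolding F_bound_def using a_nonneg b_nonneg by (intro add_nonneg_nonneg sum_nonneg) auto

text \<open>
  Off the half-line of nonpositive reals all arguments of the gamma functions avoid that half-line,
  so that \<open>ln_M\<close> is holomorphic there.
\<close>

definition regular :: "complex \<Rightarrow> bool" where
  "regular s \<longleftrightarrow> Im s \<noteq> 0 \<or> Re s > 0"

lemma regular_not_nonpos_Reals:
  assumes "regular s" "r > 0" "c \<ge> 0"
  shows   "of_real r * s + of_real c \<notin> \<real>\<^sub>\<le>\<^sub>0"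
  using assms by (auto simp: complex_nonpos_Reals_iff regular_def add_pos_nonneg not_le)

lemma M_eq_exp_ln_M:
  assumes "regular s"
  shows   "M s = exp (ln_M s)"
proof -
  have Gamma: "Gamma (of_real r * s + of_real c) = exp (ln_Gamma (of_real r * s + of_real c))"
    if "r > 0" "c \<ge> 0" for r c
    using regular_not_nonpos_Reals [OF assms that] nonpos_Ints_subset_nonpos_Reals
    by (auto simp: Gamma_complex_altdef)
  show ?thesis
    unfolding M_def ln_M_def exp_diff exp_sum [OF finite_atLeastAtMost] using A_pos B_pos a_nonneg b_nonneg
    by (intro arg_cong2 [of _ _ _ _ "(/)"] prod.cong Gamma) auto
qed

lemma ln_M_has_field_derivative:
  assumes "regular s"
  shows   "(ln_M has_field_derivative D s) (at s within S)"
proof -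
  have deriv: "((\<lambda>s. ln_Gamma (of_real r * s + of_real c)) has_field_derivative
                  of_real r * Digamma (of_real r * s + of_real c)) (at s within S)"
    if "r > 0" "c \<ge> 0" for r c
    using regular_not_nonpos_Reals [OF assms that]
    by (auto intro!: derivative_eq_intros simp: mult_ac)
  show ?thesis
    unfolding ln_M_def [abs_def] D_def using A_pos B_pos a_nonneg b_nonneg
    by (intro DERIV_diff DERIV_sum deriv) auto
qed

lemma M_has_field_derivative:
  assumes "Re s \<ge> 1"
  shows   "(M has_field_derivative (of_real (ln \<rho>) - F s) * M s) (at s)"
proof -
  have reg: "regular z" if "z \<in> {z. Re z > 0}" for z
    using that by (simp add: regular_def)
  have s: "s \<in> {z. Re z > 0}" using assms by simp
  have "((\<lambda>s. exp (ln_M s)) has_field_derivative exp (ln_M s) * D s) (at s)"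
    by (intro DERIV_chain [of exp, unfolded o_def] ln_M_has_field_derivative reg s) (rule DERIV_exp)
  hence "(M has_field_derivative exp (ln_M s) * D s) (at s)"
    by (rule has_field_derivative_transform_within_open [OF _ open_halfspace_Re_gt [of 0] s])
       (use reg in \<open>auto simp: M_eq_exp_ln_M\<close>)
  thus ?thesis
    using D_eq [OF assms] M_eq_exp_ln_M [OF reg [OF s]] by (simp add: mult_ac)
qed

lemma ln_M_eq:
  assumes "Re s \<ge> 1"
  shows   "ln_M s = ln_M 1 + (s - 1) * of_real (ln \<rho>) - unit_mellin_prim Q s"
proof -
  interpret Q: bounded_weight Q Q_bound by (rule bounded_weight_Q)
  have "\<exists>c. \<forall>x\<in>{s. Re s \<ge> 1}. ln_M x - (x - 1) * of_real (ln \<rho>) + unit_mellin_prim Q x = c"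
  proof (rule has_field_derivative_zero_constant [OF convex_halfplane_Re_ge1])
    fix z assume z: "z \<in> {s. Re s \<ge> 1}"
    have "((\<lambda>x. ln_M x - (x - 1) * of_real (ln \<rho>) + unit_mellin_prim Q x)
             has_field_derivative (D z - (1 * of_real (ln \<rho>)) + F z)) (at z within {s. Re s \<ge> 1})"
      unfolding F_def
      by (intro DERIV_add DERIV_diff ln_M_has_field_derivative Q.prim_has_field_derivative DERIV_cmult_right)
         (use z in \<open>auto simp: regular_def intro!: derivative_eq_intros\<close>)
    thus "((\<lambda>x. ln_M x - (x - 1) * of_real (ln \<rho>) + unit_mellin_prim Q x)
             has_field_derivative 0) (at z within {s. Re s \<ge> 1})"
      using z by (simp add: D_eq)
  qed
  then obtain c where c: "\<And>x. Re x \<ge> 1 \<Longrightarrow> ln_M x - (x - 1) * of_real (ln \<rho>) + unit_mellin_prim Q x = c"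
    by auto
  show ?thesis using c [OF assms] c [of 1] by (simp add: Q.prim_at_1 algebra_simps)
qed

text \<open>
  Near \<open>u = 1\<close> the weight \<open>Q\<close> exceeds some \<open>\<nu> > 0\<close>, because its limit there is \<open>\<mu> > 0\<close>. Comparing
  the primitive of \<open>Q\<close> with the one of the constant \<open>\<nu>\<close>, which is \<open>\<nu> Ln s\<close>, gives the decay of \<open>M\<close>.
\<close>

lemma M_decay_exists:
  obtains \<nu> C where "0 < \<nu>" "\<nu> < 1" "C > 0"
    "\<And>s. Re s \<ge> 1 \<Longrightarrow> norm (M s) \<le> C * \<rho> powr Re s * norm s powr (-\<nu>)"
proof -
  \<comment> \<open>Besides \<open>\<nu> < \<mu>\<close>, the later bounds need \<open>\<nu> < 1\<close>.\<close>
  define \<nu> where "\<nu> = min (fox_mu p q a b) 1 / 2"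
  have \<nu>: "0 < \<nu>" "\<nu> < 1" "\<nu> < fox_mu p q a b"
    using mu_pos by (auto simp: \<nu>_def min_def)
  have "\<forall>\<^sub>F u in at_left 1. Q u > \<nu>"
    using Q_tendsto_mu \<nu>(3) by (rule order_tendstoD)
  moreover have "\<forall>\<^sub>F u in at_left (1::real). u \<in> {0<..<1}"
    by (rule eventually_at_leftI [of 0]) auto
  ultimately have "\<forall>\<^sub>F u in at_left 1. Q u > \<nu> \<and> u \<in> {0<..<1}"
    by eventually_elim auto
  then obtain u\<^sub>0 where u0: "u\<^sub>0 < 1" "\<And>u. u\<^sub>0 < u \<Longrightarrow> u < 1 \<Longrightarrow> Q u > \<nu>"
    by (auto simp: eventually_at_left_field)
  define u\<^sub>1 where "u\<^sub>1 = max u\<^sub>0 (1/2)"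
  have u1: "0 < u\<^sub>1" "u\<^sub>1 < 1" using u0(1) by (auto simp: u\<^sub>1_def)
  interpret Q: bounded_weight Q Q_bound by (rule bounded_weight_Q)
  have nu: "bounded_weight (\<lambda>_. \<nu>) \<nu>" using \<nu> by unfold_locales auto
  interpret W: bounded_weight "\<lambda>u. Q u - \<nu>" "Q_bound + \<nu>"
    by (rule bounded_weight_diff [OF bounded_weight_Q nu])
  define E where "E = 2 * (Q_bound + \<nu>) / ln u\<^sub>1"
  define C where "C = exp (Re (ln_M 1) - ln \<rho> - E)"
  have "norm (M s) \<le> C * \<rho> powr Re s * norm s powr (-\<nu>)" if s: "Re s \<ge> 1" for s
  proof -
    have s0: "s \<noteq> 0" using s by auto
    have "E \<le> Re (unit_mellin_prim (\<lambda>u. Q u - \<nu>) s)"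
      unfolding E_def by (rule W.Re_prim_ge) (use u0 u1 s in \<open>auto simp: u\<^sub>1_def intro: less_imp_le\<close>)
    also have "unit_mellin_prim (\<lambda>u. Q u - \<nu>) s = unit_mellin_prim Q s - unit_mellin_prim (\<lambda>_. \<nu>) s"
      by (rule unit_mellin_prim_diff [OF bounded_weight_Q nu s])
    also have "unit_mellin_prim (\<lambda>_. \<nu>) s = of_real \<nu> * unit_mellin_prim (\<lambda>_. 1) s"
      by (simp add: unit_mellin_prim_def scaleR_conv_of_real flip: set_integral_mult_right)
    also have "\<dots> = of_real \<nu> * Ln s"
      by (simp add: unit_mellin_prim_one s)
    finally have "E \<le> Re (unit_mellin_prim Q s) - \<nu> * ln (norm s)"
      using s0 by simp
    hence "Re (ln_M s) \<le> (Re (ln_M 1) - ln \<rho> - E) + Re s * ln \<rho> + (-\<nu>) * ln (norm s)"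
      by (simp add: ln_M_eq [OF s] algebra_simps)
    hence "exp (Re (ln_M s)) \<le> C * exp (Re s * ln \<rho>) * exp ((-\<nu>) * ln (norm s))"
      unfolding C_def exp_add [symmetric] by simp
    moreover have "norm (M s) = exp (Re (ln_M s))"
      using s by (subst M_eq_exp_ln_M) (auto simp: regular_def)
    ultimately show ?thesis using s0 rho_pos by (simp add: powr_def)
  qed
  moreover have "C > 0" by (simp add: C_def)
  ultimately show ?thesis using that \<nu> by blast
qed

end

section \<open>Vertical strips\<close>

lemma norm_Polygamma_1_le:
  assumes "\<beta> > 0"
  obtains S where "S \<ge> 0" "\<And>z::complex. Re z \<ge> - r \<Longrightarrow> \<bar>Im z\<bar> \<ge> \<beta> \<Longrightarrow> norm (Polygamma 1 z) \<le> S"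
proof -
  obtain N :: nat where N: "r \<le> real N" using real_arch_simple by blast
  \<comment> \<open>The first terms are bounded through the imaginary part, the others through the real part.\<close>
  define h where "h = (\<lambda>k. if k \<le> N then inverse (\<beta>\<^sup>2) else inverse (real (k - N) ^ 2))"
  have h_nonneg: "h k \<ge> 0" for k by (simp add: h_def)
  have h_summable: "summable h"
  proof (subst summable_iff_shift [of h "Suc N", symmetric])
    have "summable (\<lambda>n. inverse (real (Suc n) ^ 2))"
      by (subst summable_Suc_iff) (rule inverse_power_summable, simp)
    thus "summable (\<lambda>n. h (n + Suc N))" by (simp add: h_def)
  qed
  have "norm (Polygamma 1 z) \<le> suminf h" if z: "Re z \<ge> - r" "\<bar>Im z\<bar> \<ge> \<beta>" for z :: complex
  proof -
    have le: "norm (inverse ((z + of_nat k)\<^sup>2)) \<le> h k" for k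
    proof (cases "k \<le> N")
      case True
      have "\<beta> \<le> norm (z + of_nat k)" using abs_Im_le_cmod [of "z + of_nat k"] z by simp
      hence "\<beta>\<^sup>2 \<le> norm (z + of_nat k) ^ 2" using assms by (intro power_mono) auto
      thus ?thesis using True assms
        by (simp add: h_def norm_inverse norm_power le_imp_inverse_le)
    next
      case False
      have "real (k - N) \<le> Re (z + of_nat k)" using False z N by (simp add: of_nat_diff)
      also have "\<dots> \<le> norm (z + of_nat k)" by (rule complex_Re_le_cmod)
      finally have "real (k - N) ^ 2 \<le> norm (z + of_nat k) ^ 2" by (intro power_mono) auto
      thus ?thesis using False
        by (simp add: h_def norm_inverse norm_power le_imp_inverse_le)
    qed
    have "norm (Polygamma 1 z) = norm (\<Sum>k. inverse ((z + of_nat k)\<^sup>2))"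
      by (simp add: Polygamma_def numeral_2_eq_2)
    also have "\<dots> \<le> suminf h"
      by (rule norm_suminf_le [OF le h_summable])
    finally show ?thesis .
  qed
  moreover have "suminf h \<ge> 0" using h_summable h_nonneg by (intro suminf_nonneg)
  ultimately show ?thesis using that by blast
qed

context fox_params
begin

definition D' :: "complex \<Rightarrow> complex" where
  "D' s = (\<Sum>k=1..p. of_real ((A k)\<^sup>2) * Polygamma 1 (of_real (A k) * s + of_real (a k))) -
          (\<Sum>j=1..q. of_real ((B j)\<^sup>2) * Polygamma 1 (of_real (B j) * s + of_real (b j)))"

lemma D_has_field_derivative:
  assumes "regular s"
  shows   "(D has_field_derivative D' s) (at s within S)"
proof -
  have deriv: "((\<lambda>s. of_real r * Digamma (of_real r * s + of_real c)) has_field_derivative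
                  of_real (r\<^sup>2) * Polygamma 1 (of_real r * s + of_real c)) (at s within S)"
    if "r > 0" "c \<ge> 0" for r c
  proof -
    have "of_real r * s + of_real c \<notin> \<int>\<^sub>\<le>\<^sub>0"
      using regular_not_nonpos_Reals [OF assms that] nonpos_Ints_subset_nonpos_Reals by auto
    hence "((\<lambda>s. Digamma (of_real r * s + of_real c)) has_field_derivative
              Polygamma (Suc 0) (of_real r * s + of_real c) * of_real r) (at s within S)"
      by (intro DERIV_chain2 [OF has_field_derivative_Polygamma [where n = 0, where A = UNIV]])
         (auto intro!: derivative_eq_intros)
    hence "((\<lambda>s. of_real r * Digamma (of_real r * s + of_real c)) has_field_derivative
              of_real r * (Polygamma (Suc 0) (of_real r * s + of_real c) * of_real r)) (at s within S)"
      by (rule DERIV_cmult)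
    thus ?thesis by (simp add: power2_eq_square mult_ac)
  qed
  show ?thesis
    unfolding D_def [abs_def] D'_def using A_pos B_pos a_nonneg b_nonneg
    by (intro DERIV_diff DERIV_sum deriv) auto
qed

lemma norm_D'_le:
  obtains L where "L \<ge> 0" "\<And>s. \<bar>Im s\<bar> \<ge> 1 \<Longrightarrow> Re s \<ge> - r \<Longrightarrow> norm (D' s) \<le> L"
proof -
  have "\<exists>S. S \<ge> 0 \<and> (\<forall>s. \<bar>Im s\<bar> \<ge> 1 \<longrightarrow> Re s \<ge> - r \<longrightarrow>
           norm (of_real (\<alpha>\<^sup>2) * Polygamma 1 (of_real \<alpha> * s + of_real c :: complex)) \<le> S)"
    if \<alpha>: "\<alpha> > 0" and c: "c \<ge> 0" for \<alpha> c :: real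
  proof -
    obtain S where S: "S \<ge> 0" "\<And>z::complex. Re z \<ge> - (\<alpha> * r) \<Longrightarrow> \<bar>Im z\<bar> \<ge> \<alpha> \<Longrightarrow> norm (Polygamma 1 z) \<le> S"
      using norm_Polygamma_1_le [OF \<alpha>, of "\<alpha> * r"] by blast
    have "norm (of_real (\<alpha>\<^sup>2) * Polygamma 1 (of_real \<alpha> * s + of_real c :: complex)) \<le> \<alpha>\<^sup>2 * S"
      if s: "\<bar>Im s\<bar> \<ge> 1" "Re s \<ge> - r" for s
    proof -
      have "\<alpha> * Re s \<ge> \<alpha> * (- r)" using s \<alpha> by (intro mult_left_mono) auto
      moreover have "\<alpha> * 1 \<le> \<alpha> * \<bar>Im s\<bar>" using s \<alpha> by (intro mult_left_mono) auto
      ultimately have "norm (Polygamma 1 (of_real \<alpha> * s + of_real c :: complex)) \<le> S"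
        using \<alpha> c by (intro S(2)) (auto simp: abs_mult)
      thus ?thesis unfolding norm_mult by (intro mult_mono) (simp_all add: norm_power)
    qed
    thus ?thesis using S(1) by (intro exI [of _ "\<alpha>\<^sup>2 * S"]) auto
  qed
  then obtain S where S: "\<And>\<alpha> c. \<alpha> > 0 \<Longrightarrow> c \<ge> 0 \<Longrightarrow> S \<alpha> c \<ge> 0"
    "\<And>\<alpha> c s. \<alpha> > 0 \<Longrightarrow> c \<ge> 0 \<Longrightarrow> \<bar>Im s\<bar> \<ge> 1 \<Longrightarrow> Re s \<ge> - r \<Longrightarrow>
        norm (of_real (\<alpha>\<^sup>2) * Polygamma 1 (of_real \<alpha> * s + of_real c :: complex)) \<le> S \<alpha> c"
    by metis
  define L where "L = (\<Sum>k=1..p. S (A k) (a k)) + (\<Sum>j=1..q. S (B j) (b j))"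
  have "norm (D' s) \<le> L" if "\<bar>Im s\<bar> \<ge> 1" "Re s \<ge> - r" for s
    unfolding D'_def L_def using that A_pos B_pos a_nonneg b_nonneg
    by (intro order_trans [OF norm_triangle_ineq4] add_mono order_trans [OF norm_sum] sum_mono S(2)) auto
  moreover have "L \<ge> 0"
    unfolding L_def using A_pos B_pos a_nonneg b_nonneg by (intro add_nonneg_nonneg sum_nonneg S(1)) auto
  ultimately show ?thesis using that by blast
qed

text \<open>
  The Mellin representation of \<open>F\<close> need not reach all lines to the right of \<open>fox_gamma\<close>. There
  the trigamma series bounds \<open>D'\<close> away from the real axis, hence \<open>D\<close> and, by the mean value
  theorem, the variation of \<open>ln_M\<close>.
\<close>

lemma norm_M_strip_le:
  obtains L where "L > 0"
    "\<And>\<sigma> T. \<bar>\<sigma> - 1\<bar> \<le> r \<Longrightarrow> \<bar>T\<bar> \<ge> 1 \<Longrightarrow> norm (M (Complex \<sigma> T)) \<le> L * norm (M (Complex 1 T))"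
proof -
  obtain L\<^sub>1 where L1: "L\<^sub>1 \<ge> 0" "\<And>s. \<bar>Im s\<bar> \<ge> 1 \<Longrightarrow> Re s \<ge> - (r - 1) \<Longrightarrow> norm (D' s) \<le> L\<^sub>1"
    using norm_D'_le [of "r - 1"] by blast
  define L\<^sub>0 where "L\<^sub>0 = \<bar>ln \<rho>\<bar> + F_bound + L\<^sub>1 * r"
  have "norm (M (Complex \<sigma> T)) \<le> exp (L\<^sub>0 * r) * norm (M (Complex 1 T))"
    if \<sigma>: "\<bar>\<sigma> - 1\<bar> \<le> r" and T: "\<bar>T\<bar> \<ge> 1" for \<sigma> T
  proof -
    let ?s = "Complex \<sigma> T" and ?s\<^sub>1 = "Complex 1 T"
    define S where "S = closed_segment ?s\<^sub>1 ?s"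
    have S: "Im z = T \<and> \<bar>Re z - 1\<bar> \<le> r \<and> regular z" if "z \<in> S" for z
      using that \<sigma> T
      by (auto simp: S_def closed_segment_same_Im closed_segment_eq_real_ivl regular_def split: if_splits)
    have ends: "?s \<in> S" "?s\<^sub>1 \<in> S" by (auto simp: S_def)
    have conv: "convex S" by (simp add: S_def)
    have r0: "r \<ge> 0" using \<sigma> by linarith
    have dist: "norm (z - ?s\<^sub>1) \<le> r" if "z \<in> S" for z
      using S [OF that] cmod_le [of "z - ?s\<^sub>1"] by simp
    have D1: "norm (D ?s\<^sub>1) \<le> \<bar>ln \<rho>\<bar> + F_bound"
    proof -
      have "norm ?s\<^sub>1 \<ge> 1" using complex_Re_le_cmod [of ?s\<^sub>1] by simp
      hence "F_bound / norm ?s\<^sub>1 \<le> F_bound" using F_bound_nonneg frac_le [of F_bound F_bound 1 "norm ?s\<^sub>1"] by simp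
      hence "norm (F ?s\<^sub>1) \<le> F_bound" using norm_F_le [of ?s\<^sub>1] by simp
      thus ?thesis using norm_triangle_ineq4 [of "of_real (ln \<rho>)" "F ?s\<^sub>1"] by (simp add: D_eq)
    qed
    have D: "norm (D z) \<le> L\<^sub>0" if z: "z \<in> S" for z
    proof -
      have "norm (D z - D ?s\<^sub>1) \<le> L\<^sub>1 * norm (z - ?s\<^sub>1)"
      proof (rule field_differentiable_bound [OF conv _ _ z ends(2)])
        fix w assume w: "w \<in> S"
        show "(D has_field_derivative D' w) (at w within S)"
          using S [OF w] by (intro D_has_field_derivative) auto
        show "norm (D' w) \<le> L\<^sub>1"
          using S [OF w] T by (intro L1(2)) auto
      qed
      also have "\<dots> \<le> L\<^sub>1 * r" using dist [OF z] L1(1) by (intro mult_left_mono)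
      finally show ?thesis
        using D1 norm_triangle_sub [of "D z" "D ?s\<^sub>1"] unfolding L\<^sub>0_def by linarith
    qed
    have "norm (ln_M ?s - ln_M ?s\<^sub>1) \<le> L\<^sub>0 * norm (?s - ?s\<^sub>1)"
    proof (rule field_differentiable_bound [OF conv _ D ends])
      show "(ln_M has_field_derivative D z) (at z within S)" if "z \<in> S" for z
        using S [OF that] by (intro ln_M_has_field_derivative) auto
    qed
    also have "\<dots> \<le> L\<^sub>0 * r"
      using dist [OF ends(1)] L1(1) F_bound_nonneg r0 by (intro mult_left_mono) (auto simp: L\<^sub>0_def)
    finally have "Re (ln_M ?s - ln_M ?s\<^sub>1) \<le> L\<^sub>0 * r"
      using complex_Re_le_cmod order_trans by blast
    hence "exp (Re (ln_M ?s)) \<le> exp (L\<^sub>0 * r) * exp (Re (ln_M ?s\<^sub>1))"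
      by (simp flip: exp_add)
    thus ?thesis
      using S [OF ends(1)] S [OF ends(2)] by (simp add: M_eq_exp_ln_M)
  qed
  thus ?thesis using that [of "exp (L\<^sub>0 * r)"] by simp
qed

lemma M_holomorphic: "M holomorphic_on {s. Re s > fox_gamma p A a}"
proof -
  have pos: "Re (of_real (A k) * s + of_real (a k)) > 0"
    if k: "k \<in> {1..p}" and s: "Re s > fox_gamma p A a" for k s
  proof -
    have "Min ((\<lambda>k. a k / A k) ` {1..p}) \<le> a k / A k"
      using k by (intro Min_le) auto
    hence "Re s > - (a k / A k)" using s by (simp add: fox_gamma_def)
    thus ?thesis using A_pos [OF k] by (simp add: field_simps)
  qed
  have not_nonpos_Int: "of_real (A k) * s + of_real (a k) \<notin> \<int>\<^sub>\<le>\<^sub>0"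
    if "k \<in> {1..p}" "s \<in> {s. Re s > fox_gamma p A a}" for k s
    using pos [of k s] that nonpos_Ints_subset_nonpos_Reals complex_nonpos_Reals_iff
    by (metis mem_Collect_eq not_less subsetD)
  have "(\<lambda>s. (\<Prod>k=1..p. Gamma (of_real (A k) * s + of_real (a k))) *
             (\<Prod>j=1..q. rGamma (of_real (B j) * s + of_real (b j)))) holomorphic_on
          {s. Re s > fox_gamma p A a}"
    by (intro holomorphic_intros not_nonpos_Int) auto
  thus ?thesis
    by (simp add: M_def [abs_def] rGamma_inverse_Gamma prod_inversef [symmetric] o_def divide_inverse)
qed

end

section \<open>Convergence of the inversion integral\<close>

text \<open>
  Adding the values at conjugate points turns an integral over a symmetric vertical segment into one
  over \<open>{0..R}\<close>.
\<close>

definition line_pair :: "(complex \<Rightarrow> complex) \<Rightarrow> real \<Rightarrow> real \<Rightarrow> complex" where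
  "line_pair f c t = f (Complex c t) + f (Complex c (-t))"

lemma contour_integral_vertical_conv_line_pair:
  assumes cont: "continuous_on UNIV (\<lambda>t. f (Complex c t))" and R: "R > 0"
  shows   "contour_integral (linepath (Complex c (-R)) (Complex c R)) f =
             \<i> * (LINT t:{0..R}|lborel. line_pair f c t)"
proof -
  define \<phi> where "\<phi> = (\<lambda>t. f (Complex c t))"
  have c1: "continuous_on X \<phi>" for X
    unfolding \<phi>_def using cont by (rule continuous_on_subset) auto
  have c2: "continuous_on X (\<lambda>t. \<phi> (-t))" for X
    by (rule continuous_on_compose2 [OF c1 [of UNIV]]) (auto intro!: continuous_intros)
  have "contour_integral (linepath (Complex c (-R)) (Complex c R)) f = \<i> * integral {-R..R} \<phi>"
    using R by (subst contour_integral_linepath_same_Re [of _ c _ "-R" R]) (auto simp: \<phi>_def)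
  also have "integral {-R..R} \<phi> = integral {-R..0} \<phi> + integral {0..R} \<phi>"
    using R by (intro Henstock_Kurzweil_Integration.integral_combine [symmetric] integrable_continuous_interval c1) auto
  also have "integral {-R..0} \<phi> = integral {0..R} (\<lambda>t. \<phi> (-t))"
    using Henstock_Kurzweil_Integration.integral_reflect_real [of R 0 "\<lambda>t. \<phi> (-t)"] by simp
  also have "integral {0..R} (\<lambda>t. \<phi> (-t)) + integral {0..R} \<phi> = integral {0..R} (\<lambda>t. \<phi> (-t) + \<phi> t)"
    by (intro Henstock_Kurzweil_Integration.integral_add [symmetric] integrable_continuous_interval c1 c2)
  also have "\<dots> = (LINT t:{0..R}|lborel. \<phi> (-t) + \<phi> t)"
    by (intro set_borel_integral_eq_integral(2) [symmetric] borel_integrable_atLeastAtMost' continuous_intros c1 c2)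
  finally show ?thesis by (simp add: \<phi>_def line_pair_def add.commute)
qed

lemma has_vector_derivative_along_vertical:
  assumes "(f has_field_derivative f') (at (Complex c t))"
  shows   "((\<lambda>t. f (Complex c t)) has_vector_derivative \<i> * f') (at t within X)"
proof -
  have "((\<lambda>t. of_real c + \<i> * of_real t) has_vector_derivative \<i>) (at t within X)"
    by (auto intro!: derivative_eq_intros simp: has_vector_derivative_def scaleR_conv_of_real mult.commute)
  hence "(Complex c has_vector_derivative \<i>) (at t within X)"
    by (simp add: Complex_eq [abs_def])
  hence "((f \<circ> Complex c) has_vector_derivative (\<i> * f')) (at t within X)"
    by (rule field_vector_diff_chain_within) (rule has_field_derivative_at_within [OF assms])
  thus ?thesis by (simp add: o_def)
qed

lemma norm_Complex_ge_max:
  assumes "c \<ge> 1" "t \<ge> 0"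
  shows   "norm (Complex c t) \<ge> max 1 t" "norm (Complex c (-t)) \<ge> max 1 t"
  using assms abs_Re_le_cmod [of "Complex c t"] abs_Im_le_cmod [of "Complex c t"]
        abs_Re_le_cmod [of "Complex c (-t)"] abs_Im_le_cmod [of "Complex c (-t)"] by auto

lemma set_integrable_max_powr:
  assumes "\<nu> > 0"
  shows   "set_integrable lborel {0..} (\<lambda>t::real. max 1 t powr (-1 - \<nu>))"
proof -
  have "set_integrable lborel {1..} (\<lambda>t::real. t powr (-1 - \<nu>))"
  proof -
    have "(\<lambda>t::real. t powr (-1 - \<nu>)) integrable_on {1..}"
      using has_integral_powr_to_inf [of "-1 - \<nu>" 1] assms by (auto simp: integrable_on_def)
    hence "(\<lambda>t::real. t powr (-1 - \<nu>)) absolutely_integrable_on {1..}"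
      by (rule nonnegative_absolutely_integrable_1) auto
    thus ?thesis
      unfolding set_integrable_def by (subst (asm) integrable_completion) auto
  qed
  also have "set_integrable lborel {1..} (\<lambda>t::real. t powr (-1 - \<nu>)) \<longleftrightarrow>
               set_integrable lborel {1..} (\<lambda>t::real. max 1 t powr (-1 - \<nu>))"
    by (rule set_integrable_cong) (auto simp: max_absorb2)
  finally have "set_integrable lborel {1..} (\<lambda>t::real. max 1 t powr (-1 - \<nu>))" .
  moreover have "set_integrable lborel {0..1} (\<lambda>t::real. max 1 t powr (-1 - \<nu>))"
    by (intro borel_integrable_atLeastAtMost' continuous_intros) auto
  ultimately have "set_integrable lborel ({0..1} \<union> {1..}) (\<lambda>t::real. max 1 t powr (-1 - \<nu>))"
    by (intro set_integrable_Un) auto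
  also have "{0..1} \<union> {1..} = {0::real..}" by auto
  finally show ?thesis .
qed

locale fox_decay = fox_params +
  fixes \<nu> C :: real
  assumes nu: "0 < \<nu>" "\<nu> < 1" and C_pos: "C > 0"
      and norm_M_decay: "\<And>s. Re s \<ge> 1 \<Longrightarrow> norm (M s) \<le> C * \<rho> powr Re s * norm s powr (-\<nu>)"
begin

definition P :: "real \<Rightarrow> complex \<Rightarrow> complex" where
  "P y s = M s * of_real y powr (-s)"

definition FP :: "real \<Rightarrow> complex \<Rightarrow> complex" where
  "FP y s = F s * P y s"

lemma fox_integrand_eq: "fox_integrand p q A a B b y = P y"
  by (simp add: fun_eq_iff fox_integrand_def P_def M_def)

lemma norm_P: "y > 0 \<Longrightarrow> norm (P y s) = norm (M s) * y powr (- Re s)"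
  by (simp add: P_def norm_mult norm_powr_real_powr)

lemma norm_P_le:
  assumes "y > 0" "Re s \<ge> 1" "0 < r" "r \<le> norm s"
  shows   "norm (P y s) \<le> C * (\<rho> / y) powr Re s * r powr (-\<nu>)"
proof -
  have "norm (P y s) \<le> (C * \<rho> powr Re s * norm s powr (-\<nu>)) * y powr (- Re s)"
    using norm_M_decay [OF assms(2)] assms by (simp add: norm_P mult_right_mono)
  also have "\<dots> \<le> (C * \<rho> powr Re s * r powr (-\<nu>)) * y powr (- Re s)"
    using assms C_pos nu by (intro mult_right_mono mult_left_mono powr_mono2') auto
  also have "\<dots> = C * (\<rho> / y) powr Re s * r powr (-\<nu>)"
    using assms rho_pos by (simp add: powr_divide powr_minus field_simps)
  finally show ?thesis .
qed

lemma norm_FP_le: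
  assumes "y > 0" "Re s \<ge> 1" "0 < r" "r \<le> norm s"
  shows   "norm (FP y s) \<le> F_bound * C * (\<rho> / y) powr Re s * r powr (-1 - \<nu>)"
proof -
  have "norm (FP y s) \<le> (F_bound / r) * (C * (\<rho> / y) powr Re s * r powr (-\<nu>))"
    unfolding FP_def norm_mult
  proof (rule mult_mono [OF _ norm_P_le [OF assms]])
    show "norm (F s) \<le> F_bound / r"
      by (rule order_trans [OF norm_F_le [OF assms(2)]])
         (use assms F_bound_nonneg in \<open>intro frac_le; simp\<close>)
  qed (use F_bound_nonneg assms in auto)
  also have "\<dots> = F_bound * C * (\<rho> / y) powr Re s * r powr (-1 - \<nu>)"
    using assms by (simp add: powr_diff powr_minus field_simps)
  finally show ?thesis .
qed

lemma P_has_field_derivative: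
  assumes "y > 0" "Re s \<ge> 1"
  shows   "(P y has_field_derivative of_real (ln (\<rho> / y)) * P y s - FP y s) (at s)"
proof -
  have ln: "ln (\<rho> / y) = ln \<rho> - ln y" using assms rho_pos by (simp add: ln_div)
  have "((\<lambda>s::complex. exp (- s * of_real (ln y))) has_field_derivative
           exp (- s * of_real (ln y)) * (- of_real (ln y))) (at s)"
    by (auto intro!: derivative_eq_intros)
  moreover have "(\<lambda>s::complex. exp (- s * of_real (ln y))) = (\<lambda>s. of_real y powr (-s))"
    using assms by (simp add: powr_def Ln_of_real fun_eq_iff)
  ultimately have "((\<lambda>s. of_real y powr (-s)) has_field_derivative
                      of_real y powr (-s) * (- of_real (ln y))) (at s)"
    by metis
  from DERIV_mult [OF M_has_field_derivative [OF assms(2)] this] show ?thesis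
    by (simp add: P_def [abs_def] FP_def ln algebra_simps)
qed

lemma continuous_on_line:
  assumes "\<And>s. Re s \<ge> 1 \<Longrightarrow> isCont f s" "c \<ge> 1"
  shows   "continuous_on X (\<lambda>t. f (Complex c t))"
proof (rule continuous_on_compose2 [where g = f])
  show "continuous_on {s. Re s \<ge> 1} f"
    using assms by (intro continuous_at_imp_continuous_on) auto
  show "continuous_on X (Complex c)"
    unfolding Complex_eq by (intro continuous_intros)
qed (use assms in auto)

lemma isCont_P: "y > 0 \<Longrightarrow> Re s \<ge> 1 \<Longrightarrow> isCont (P y) s"
  using P_has_field_derivative DERIV_isCont by blast

lemma continuous_on_P_line [continuous_intros]:
  "y > 0 \<Longrightarrow> c \<ge> 1 \<Longrightarrow> continuous_on X (\<lambda>t. P y (Complex c t))"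
  by (intro continuous_on_line isCont_P)

lemma continuous_on_FP_line [continuous_intros]:
  assumes "y > 0" "c \<ge> 1"
  shows   "continuous_on X (\<lambda>t. FP y (Complex c t))"
proof -
  have "isCont D s" if "Re s \<ge> 1" for s
    using D_has_field_derivative [of s UNIV] that DERIV_isCont by (force simp: regular_def)
  hence "continuous_on X (\<lambda>t. (of_real (ln \<rho>) - D (Complex c t)) * P y (Complex c t))"
    using assms by (intro continuous_intros continuous_on_line) auto
  also have "(\<lambda>t. (of_real (ln \<rho>) - D (Complex c t)) * P y (Complex c t)) = (\<lambda>t. FP y (Complex c t))"
    using assms by (simp add: FP_def D_eq)
  finally show ?thesis .
qed

lemma continuous_on_line_pair:
  assumes "continuous_on UNIV (\<lambda>t. f (Complex c t))"
  shows   "continuous_on X (line_pair f c)"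
  unfolding line_pair_def
  by (intro continuous_intros continuous_on_compose2 [OF assms, of X "\<lambda>t. t"]
        continuous_on_compose2 [OF assms, of X "\<lambda>t. -t"]) auto

lemma continuous_on_line_pair_P [continuous_intros]:
  "y > 0 \<Longrightarrow> c \<ge> 1 \<Longrightarrow> continuous_on X (line_pair (P y) c)"
  by (intro continuous_on_line_pair continuous_intros)

lemma continuous_on_line_pair_FP [continuous_intros]:
  "y > 0 \<Longrightarrow> c \<ge> 1 \<Longrightarrow> continuous_on X (line_pair (FP y) c)"
  by (intro continuous_on_line_pair continuous_intros)

lemma set_integrable_line_pair:
  assumes "y > 0" "c \<ge> 1"
  shows   "set_integrable lborel {r..R} (line_pair (P y) c)" "set_integrable lborel {r..R} (line_pair (FP y) c)"
  by (rule borel_integrable_atLeastAtMost', rule continuous_on_line_pair_P [OF assms])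
     (rule borel_integrable_atLeastAtMost', rule continuous_on_line_pair_FP [OF assms])

definition jump :: "real \<Rightarrow> real \<Rightarrow> real \<Rightarrow> complex" where
  "jump y c t = P y (Complex c t) - P y (Complex c (-t))"

lemma norm_line_pair_P_le:
  assumes "y > 0" "c \<ge> 1" "t > 0"
  shows   "norm (line_pair (P y) c t) \<le> 2 * C * (\<rho> / y) powr c * t powr (-\<nu>)"
          "norm (jump y c t) \<le> 2 * C * (\<rho> / y) powr c * t powr (-\<nu>)"
proof -
  have "norm (P y (Complex c t)) \<le> C * (\<rho> / y) powr c * t powr (-\<nu>)"
       "norm (P y (Complex c (-t))) \<le> C * (\<rho> / y) powr c * t powr (-\<nu>)"
    using norm_P_le [of y "Complex c t" t] norm_P_le [of y "Complex c (-t)" t] assms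
          norm_Complex_ge_max [of c t] by auto
  thus "norm (line_pair (P y) c t) \<le> 2 * C * (\<rho> / y) powr c * t powr (-\<nu>)"
       "norm (jump y c t) \<le> 2 * C * (\<rho> / y) powr c * t powr (-\<nu>)"
    unfolding line_pair_def jump_def
    using norm_triangle_ineq [of "P y (Complex c t)" "P y (Complex c (-t))"]
          norm_triangle_ineq4 [of "P y (Complex c t)" "P y (Complex c (-t))"] by linarith+
qed

lemma norm_line_pair_FP_le:
  assumes "y > 0" "c \<ge> 1" "t \<ge> 0"
  shows   "norm (line_pair (FP y) c t) \<le> 2 * F_bound * C * (\<rho> / y) powr c * max 1 t powr (-1 - \<nu>)"
proof -
  have "norm (FP y (Complex c t)) \<le> F_bound * C * (\<rho> / y) powr c * max 1 t powr (-1 - \<nu>)"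
       "norm (FP y (Complex c (-t))) \<le> F_bound * C * (\<rho> / y) powr c * max 1 t powr (-1 - \<nu>)"
    using norm_FP_le [of y "Complex c t" "max 1 t"] norm_FP_le [of y "Complex c (-t)" "max 1 t"] assms
          norm_Complex_ge_max [of c t] by auto
  thus ?thesis
    unfolding line_pair_def
    using norm_triangle_ineq [of "FP y (Complex c t)" "FP y (Complex c (-t))"] by linarith
qed

text \<open>
  The differential equation \<open>P' = (ln (\<rho> / y) - F) P\<close> replaces an integrand of size
  \<open>O(t powr (-\<nu>))\<close> by one of size \<open>O(t powr (-1 - \<nu>))\<close>, at the price of the factor
  \<open>1 / ln (\<rho> / y)\<close>, which is singular at \<open>y = \<rho>\<close> only.
\<close>

lemma integrate_line_pair_by_parts:
  assumes "y > 0" "c \<ge> 1" "r \<le> R"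
  shows   "of_real (ln (\<rho> / y)) * (LINT t:{r..R}|lborel. line_pair (P y) c t) =
             (LINT t:{r..R}|lborel. line_pair (FP y) c t) - \<i> * (jump y c R - jump y c r)"
proof -
  define l where "l = complex_of_real (ln (\<rho> / y))"
  have deriv: "(jump y c has_vector_derivative
                  \<i> * (l * line_pair (P y) c t - line_pair (FP y) c t)) (at t within {r..R})" for t
  proof -
    have v: "((\<lambda>t. P y (Complex c t)) has_vector_derivative
              \<i> * (l * P y (Complex c t) - FP y (Complex c t))) (at t within X)" for t X
      unfolding l_def using assms
      by (intro has_vector_derivative_along_vertical P_has_field_derivative) auto
    have "((\<lambda>t. P y (Complex c t)) \<circ> uminus has_vector_derivative
             (-1) *\<^sub>R (\<i> * (l * P y (Complex c (-t)) - FP y (Complex c (-t))))) (at t within {r..R})"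
      by (intro vector_diff_chain_within v) (auto intro!: derivative_eq_intros)
    from has_vector_derivative_diff [OF v this] show ?thesis
      by (simp add: jump_def [abs_def] o_def line_pair_def algebra_simps)
  qed
  have "(LINT t:{r..R}|lborel. \<i> * (l * line_pair (P y) c t - line_pair (FP y) c t)) = jump y c R - jump y c r"
    unfolding set_lebesgue_integral_def
    using assms by (intro integral_FTC_Icc deriv continuous_intros) auto
  also have "(LINT t:{r..R}|lborel. \<i> * (l * line_pair (P y) c t - line_pair (FP y) c t)) =
               \<i> * (l * (LINT t:{r..R}|lborel. line_pair (P y) c t) - (LINT t:{r..R}|lborel. line_pair (FP y) c t))"
    using set_integrable_line_pair [OF assms(1,2), of r R]
    by (simp add: set_integral_diff)
  finally have eq: "jump y c R - jump y c r =
      \<i> * (l * (LINT t:{r..R}|lborel. line_pair (P y) c t) - (LINT t:{r..R}|lborel. line_pair (FP y) c t))" ..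
  show ?thesis
    unfolding eq l_def [symmetric] by (simp flip: mult.assoc)
qed

lemma jump_0: "jump y c 0 = 0"
  by (simp add: jump_def)

lemma jump_tendsto_0:
  assumes "y > 0" "c \<ge> 1"
  shows   "(jump y c \<longlongrightarrow> 0) at_top"
proof (rule Lim_null_comparison)
  show "\<forall>\<^sub>F t in at_top. norm (jump y c t) \<le> 2 * C * (\<rho> / y) powr c * t powr (-\<nu>)"
    using eventually_gt_at_top [of 0] by eventually_elim (rule norm_line_pair_P_le(2) [OF assms])
  have "((\<lambda>t. t powr (-\<nu>)) \<longlongrightarrow> 0) at_top"
    using nu by (intro tendsto_neg_powr filterlim_ident) auto
  thus "((\<lambda>t. 2 * C * (\<rho> / y) powr c * t powr (-\<nu>)) \<longlongrightarrow> 0) at_top"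
    by (rule tendsto_mult_right_zero)
qed

definition line_majorant_integral :: real where "line_majorant_integral = (LINT t:{0..}|lborel. max 1 t powr (-1 - \<nu>))"

text \<open>
  The limit, for \<open>R \<rightarrow> \<infinity>\<close>, of the integral of \<open>P y (Complex c t)\<close> over \<open>-R \<le> t \<le> R\<close>, written
  through an absolutely convergent integral.
\<close>

definition line_limit :: "real \<Rightarrow> real \<Rightarrow> complex" where
  "line_limit y c = (LINT t:{0..}|lborel. line_pair (FP y) c t) / of_real (ln (\<rho> / y))"

lemma line_pair_FP_integrable:
  assumes "y > 0" "c \<ge> 1"
  shows   "set_integrable lborel {0..} (line_pair (FP y) c)"
proof (rule set_integrable_bound)
  show "set_integrable lborel {0..} (\<lambda>t. 2 * F_bound * C * (\<rho> / y) powr c * max 1 t powr (-1 - \<nu>))"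
    using nu by (intro set_integrable_mult_right set_integrable_max_powr)
  have "continuous_on UNIV (line_pair (FP y) c)"
    using assms by (intro continuous_intros)
  hence "line_pair (FP y) c \<in> borel_measurable borel"
    by (rule borel_measurable_continuous_onI)
  thus "set_borel_measurable lborel {0..} (line_pair (FP y) c)"
    unfolding set_borel_measurable_def by measurable
  show "AE t in lborel. t \<in> {0..} \<longrightarrow> norm (line_pair (FP y) c t)
           \<le> norm (2 * F_bound * C * (\<rho> / y) powr c * max 1 t powr (-1 - \<nu>))"
    using norm_line_pair_FP_le [OF assms]
    by (intro AE_I2 impI) (auto intro: order_trans [OF _ abs_ge_self])
qed

lemma line_integral_tendsto:
  assumes "y > 0" "y \<noteq> \<rho>" "c \<ge> 1"
  shows   "((\<lambda>R. LINT t:{0..R}|lborel. line_pair (P y) c t) \<longlongrightarrow> line_limit y c) at_top"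
proof -
  have ln_nz: "ln (\<rho> / y) \<noteq> 0"
    using assms rho_pos by (simp add: ln_div)
  have "((\<lambda>R. ((LINT t:{0..R}|lborel. line_pair (FP y) c t) - \<i> * (jump y c R - jump y c 0)) / of_real (ln (\<rho> / y)))
           \<longlongrightarrow> ((LINT t:{0..}|lborel. line_pair (FP y) c t) - \<i> * (0 - jump y c 0)) / of_real (ln (\<rho> / y))) at_top"
    using ln_nz assms
    by (intro tendsto_intros jump_tendsto_0 tendsto_set_lebesgue_integral_at_top line_pair_FP_integrable) auto
  also have "((LINT t:{0..}|lborel. line_pair (FP y) c t) - \<i> * (0 - jump y c 0)) / of_real (ln (\<rho> / y)) = line_limit y c"
    by (simp add: line_limit_def jump_0)
  finally show ?thesis
  proof (rule Lim_transform_eventually)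
    show "\<forall>\<^sub>F R in at_top. ((LINT t:{0..R}|lborel. line_pair (FP y) c t) - \<i> * (jump y c R - jump y c 0)) /
             of_real (ln (\<rho> / y)) = (LINT t:{0..R}|lborel. line_pair (P y) c t)"
      using eventually_ge_at_top [of 0]
    proof eventually_elim
      case (elim R)
      show ?case
        unfolding integrate_line_pair_by_parts [OF assms(1,3) elim, symmetric] using ln_nz by simp
    qed
  qed
qed

lemma norm_line_limit_le:
  assumes "y > 0" "c \<ge> 1"
  shows   "norm (line_limit y c) \<le> 2 * F_bound * C * (\<rho> / y) powr c * line_majorant_integral / \<bar>ln (\<rho> / y)\<bar>"
proof -
  have "norm (LINT t:{0..}|lborel. line_pair (FP y) c t) \<le>
          (LINT t:{0..}|lborel. 2 * F_bound * C * (\<rho> / y) powr c * max 1 t powr (-1 - \<nu>))"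
    unfolding set_lebesgue_integral_def
  proof (rule Bochner_Integration.integral_norm_bound_integral)
    show "integrable lborel (\<lambda>t. indicat_real {0..} t *\<^sub>R line_pair (FP y) c t)"
      using line_pair_FP_integrable [OF assms] by (simp add: set_integrable_def)
    show "integrable lborel (\<lambda>t. indicat_real {0..} t *\<^sub>R
             (2 * F_bound * C * (\<rho> / y) powr c * max 1 t powr (-1 - \<nu>)))"
      using set_integrable_mult_right [OF set_integrable_max_powr [OF nu(1)],
              of "2 * F_bound * C * (\<rho> / y) powr c"] by (simp only: set_integrable_def)
    show "norm (indicat_real {0..} t *\<^sub>R line_pair (FP y) c t) \<le> indicat_real {0..} t *\<^sub>R
             (2 * F_bound * C * (\<rho> / y) powr c * max 1 t powr (-1 - \<nu>))" for t
      using norm_line_pair_FP_le [OF assms, of t] by (auto simp: indicator_def)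
  qed
  also have "\<dots> = 2 * F_bound * C * (\<rho> / y) powr c * line_majorant_integral"
    by (simp add: line_majorant_integral_def)
  finally show ?thesis
    by (simp add: line_limit_def norm_divide divide_right_mono)
qed

lemma fox_gamma_lt_1: "fox_gamma p A a < 1"
proof -
  have "0 \<le> Min ((\<lambda>k. a k / A k) ` {1..p})"
    using p_pos A_pos a_nonneg by (intro Min.boundedI) (auto intro!: divide_nonneg_pos)
  thus ?thesis by (simp add: fox_gamma_def)
qed

text \<open>
  With a primitive of \<open>P y\<close> on the convex half-plane, the difference of the integrals over two
  vertical segments is the difference of those over the two horizontal sides, where \<open>M\<close> is small.
\<close>

lemma vertical_lines_difference_tendsto_0:
  assumes y: "y > 0" and c: "c > fox_gamma p A a"
  shows   "((\<lambda>R. contour_integral (linepath (Complex c (-R)) (Complex c R)) (P y) -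
                 contour_integral (linepath (Complex 1 (-R)) (Complex 1 R)) (P y)) \<longlongrightarrow> 0) at_top"
proof -
  let ?S = "{s. Re s > fox_gamma p A a}"
  define r where "r = \<bar>c - 1\<bar>"
  obtain L where L: "L > 0" "\<And>\<sigma> T. \<bar>\<sigma> - 1\<bar> \<le> r \<Longrightarrow> \<bar>T\<bar> \<ge> 1 \<Longrightarrow>
                        norm (M (Complex \<sigma> T)) \<le> L * norm (M (Complex 1 T))"
    using norm_M_strip_le by blast
  have "P y holomorphic_on ?S"
    unfolding P_def using y by (intro holomorphic_intros M_holomorphic) auto
  then obtain g where g: "\<And>s. s \<in> ?S \<Longrightarrow> (g has_field_derivative P y s) (at s within ?S)"
    using holomorphic_convex_primitive' [OF convex_halfspace_Re_gt open_halfspace_Re_gt] by metis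
  have line: "contour_integral (linepath (Complex x (-R)) (Complex x R)) (P y) = g (Complex x R) - g (Complex x (-R))"
    if x: "x > fox_gamma p A a" for x R
  proof -
    let ?l = "linepath (Complex x (-R)) (Complex x R)"
    have "(P y has_contour_integral (g (pathfinish ?l) - g (pathstart ?l))) ?l"
      by (rule contour_integral_primitive [OF g]) (use x in \<open>auto simp: closed_segment_same_Re\<close>)
    thus ?thesis by (auto intro: contour_integral_unique)
  qed
  define E where "E = L * (C * \<rho>) * exp ((\<bar>c\<bar> + 1) * \<bar>ln y\<bar>)"
  have side: "norm (g (Complex c T) - g (Complex 1 T)) \<le> E * \<bar>T\<bar> powr (-\<nu>) * r" if T: "\<bar>T\<bar> \<ge> 1" for T
  proof -
    let ?seg = "closed_segment (Complex 1 T) (Complex c T)"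
    have seg: "Im z = T \<and> \<bar>Re z - 1\<bar> \<le> r \<and> Re z > fox_gamma p A a \<and> \<bar>Re z\<bar> \<le> \<bar>c\<bar> + 1" if "z \<in> ?seg" for z
      using that c fox_gamma_lt_1
      by (auto simp: closed_segment_same_Im closed_segment_eq_real_ivl r_def split: if_splits)
    have "norm (g (Complex c T) - g (Complex 1 T)) \<le> E * \<bar>T\<bar> powr (-\<nu>) * norm (Complex c T - Complex 1 T)"
    proof (rule field_differentiable_bound [of ?seg g "P y"])
      fix z assume z: "z \<in> ?seg"
      note z' = seg [OF z]
      show "(g has_field_derivative P y z) (at z within ?seg)"
        using g [of z] z' seg by (auto intro: DERIV_subset)
      have eq: "z = Complex (Re z) T" using z' by (simp add: complex_eq_iff)
      have "norm (M (Complex 1 T)) \<le> C * \<rho> powr 1 * norm (Complex 1 T) powr (-\<nu>)"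
        using norm_M_decay [of "Complex 1 T"] by simp
      also have "\<dots> \<le> C * \<rho> powr 1 * \<bar>T\<bar> powr (-\<nu>)"
        using abs_Im_le_cmod [of "Complex 1 T"] T C_pos rho_pos nu
        by (intro mult_left_mono powr_mono2') auto
      finally have M1: "norm (M (Complex 1 T)) \<le> C * \<rho> * \<bar>T\<bar> powr (-\<nu>)"
        using rho_pos by simp
      have "norm (M z) = norm (M (Complex (Re z) T))"
        using eq by simp
      also have "\<dots> \<le> L * norm (M (Complex 1 T))"
        using z' T by (intro L(2)) auto
      also have "\<dots> \<le> L * (C * \<rho> * \<bar>T\<bar> powr (-\<nu>))"
        using M1 L(1) by (intro mult_left_mono) auto
      finally have "norm (M z) \<le> L * (C * \<rho> * \<bar>T\<bar> powr (-\<nu>))" .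
      moreover have "y powr (- Re z) \<le> exp ((\<bar>c\<bar> + 1) * \<bar>ln y\<bar>)"
      proof -
        have "- Re z * ln y \<le> \<bar>Re z\<bar> * \<bar>ln y\<bar>" by (metis abs_ge_self abs_minus_cancel abs_mult)
        also have "\<dots> \<le> (\<bar>c\<bar> + 1) * \<bar>ln y\<bar>" using z' by (intro mult_right_mono) auto
        finally show ?thesis using y by (simp add: powr_def)
      qed
      ultimately have "norm (P y z) \<le> L * (C * \<rho> * \<bar>T\<bar> powr (-\<nu>)) * exp ((\<bar>c\<bar> + 1) * \<bar>ln y\<bar>)"
        unfolding norm_P [OF y] using L(1) C_pos rho_pos by (intro mult_mono) auto
      thus "norm (P y z) \<le> E * \<bar>T\<bar> powr (-\<nu>)" by (simp add: E_def mult_ac)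
    qed auto
    also have "norm (Complex c T - Complex 1 T) = r"
      by (simp add: r_def complex_diff cmod_def)
    finally show ?thesis .
  qed
  show ?thesis
  proof (rule Lim_null_comparison)
    show "\<forall>\<^sub>F R in at_top. norm (contour_integral (linepath (Complex c (-R)) (Complex c R)) (P y) -
                 contour_integral (linepath (Complex 1 (-R)) (Complex 1 R)) (P y)) \<le> 2 * E * r * R powr (-\<nu>)"
      using eventually_ge_at_top [of 1]
    proof eventually_elim
      case (elim R)
      have "contour_integral (linepath (Complex c (-R)) (Complex c R)) (P y) -
              contour_integral (linepath (Complex 1 (-R)) (Complex 1 R)) (P y) =
            (g (Complex c R) - g (Complex 1 R)) - (g (Complex c (-R)) - g (Complex 1 (-R)))"
        using c fox_gamma_lt_1 by (simp add: line)
      also have "norm \<dots> \<le> E * R powr (-\<nu>) * r + E * R powr (-\<nu>) * r"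
        by (rule order_trans [OF norm_triangle_ineq4], rule add_mono)
           (use side [of R] side [of "-R"] elim in auto)
      finally show ?case by simp
    qed
    have "((\<lambda>t. t powr (-\<nu>)) \<longlongrightarrow> 0) at_top"
      using nu by (intro tendsto_neg_powr filterlim_ident) auto
    thus "((\<lambda>t. 2 * E * r * t powr (-\<nu>)) \<longlongrightarrow> 0) at_top"
      by (rule tendsto_mult_right_zero)
  qed
qed

lemma has_fox_H_line_limit:
  assumes "y > 0" "y \<noteq> \<rho>" "c \<ge> 1"
  shows   "has_fox_H p q A a B b y (line_limit y c / (2 * of_real pi))"
  unfolding has_fox_H_def fox_integrand_eq
proof (intro allI impI)
  fix c' assume c': "c' > fox_gamma p A a"
  define I where "I = (\<lambda>c R. contour_integral (linepath (Complex c (-R)) (Complex c R)) (P y))"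
  have "((\<lambda>R. \<i> * (LINT t:{0..R}|lborel. line_pair (P y) c t)) \<longlongrightarrow> \<i> * line_limit y c) at_top"
    by (intro tendsto_intros line_integral_tendsto assms)
  moreover have "\<forall>\<^sub>F R in at_top. \<i> * (LINT t:{0..R}|lborel. line_pair (P y) c t) = I c R"
    using eventually_gt_at_top [of 0]
  proof eventually_elim
    case (elim R)
    show ?case unfolding I_def using assms elim
      by (intro contour_integral_vertical_conv_line_pair [symmetric] continuous_intros)
  qed
  ultimately have lim: "(I c \<longlongrightarrow> \<i> * line_limit y c) at_top"
    by (rule Lim_transform_eventually)
  have "((\<lambda>R. I c R + (I c' R - I 1 R) - (I c R - I 1 R)) \<longlongrightarrow> \<i> * line_limit y c + 0 - 0) at_top"
    unfolding I_def using lim [unfolded I_def] assms c' fox_gamma_lt_1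
    by (intro tendsto_add tendsto_diff vertical_lines_difference_tendsto_0) auto
  hence "(I c' \<longlongrightarrow> \<i> * line_limit y c) at_top" by simp
  hence "((\<lambda>R. 1 / (2 * of_real pi * \<i>) * I c' R) \<longlongrightarrow> 1 / (2 * of_real pi * \<i>) * (\<i> * line_limit y c)) at_top"
    by (intro tendsto_intros)
  thus "((\<lambda>R. 1 / (2 * of_real pi * \<i>) * contour_integral (linepath (Complex c' (-R)) (Complex c' R)) (P y))
           \<longlongrightarrow> line_limit y c / (2 * of_real pi)) at_top"
    by (simp add: I_def)
qed

lemma has_fox_H_unique:
  assumes "has_fox_H p q A a B b y L" "has_fox_H p q A a B b y L'"
  shows   "L = L'"
  using assms fox_gamma_lt_1 unfolding has_fox_H_def
  by (meson tendsto_unique trivial_limit_at_top_linorder)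

lemma fox_H_eq_line_limit:
  assumes "y > 0" "y \<noteq> \<rho>" "c \<ge> 1"
  shows   "fox_H p q A a B b y = line_limit y c / (2 * of_real pi)"
  unfolding fox_H_def
  using has_fox_H_line_limit [OF assms] has_fox_H_unique by (intro the_equality) auto

text \<open>
  The bound on \<open>line_limit y c\<close> decays like \<open>(\<rho> / y) powr c\<close>, while its value does not depend on \<open>c\<close>.
\<close>

lemma fox_H_eq_0:
  assumes "y > \<rho>"
  shows   "fox_H p q A a B b y = 0"
proof -
  have y: "y > 0" "y \<noteq> \<rho>" using assms rho_pos by auto
  define L where "L = line_limit y 1"
  have L: "line_limit y c = L" if "c \<ge> 1" for c
    using fox_H_eq_line_limit [OF y that] fox_H_eq_line_limit [OF y, of 1] by (simp add: L_def)
  have "((\<lambda>c::real. L) \<longlongrightarrow> 0) at_top"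
  proof (rule Lim_null_comparison)
    show "\<forall>\<^sub>F c in at_top. norm L \<le> 2 * F_bound * C * line_majorant_integral / \<bar>ln (\<rho> / y)\<bar> * (\<rho> / y) powr c"
      using eventually_ge_at_top [of 1]
    proof eventually_elim
      case (elim c)
      thus ?case using norm_line_limit_le [OF y(1) elim] L [OF elim] by (simp add: mult_ac)
    qed
    have "((\<lambda>c. exp (ln (\<rho> / y) * c)) \<longlongrightarrow> 0) at_top"
      using rho_pos y assms
      by (intro filterlim_compose [OF exp_at_bot]
            filterlim_tendsto_neg_mult_at_bot [OF tendsto_const _ filterlim_ident]) auto
    hence "((\<lambda>c. (\<rho> / y) powr c) \<longlongrightarrow> 0) at_top"
      using rho_pos y by (simp add: powr_def mult.commute)
    thus "((\<lambda>c. 2 * F_bound * C * line_majorant_integral / \<bar>ln (\<rho> / y)\<bar> * (\<rho> / y) powr c) \<longlongrightarrow> 0) at_top"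
      by (rule tendsto_mult_right_zero)
  qed
  hence "L = 0" by (simp add: tendsto_const_iff)
  thus ?thesis using fox_H_eq_line_limit [OF y, of 1] by (simp add: L_def)
qed

end

section \<open>The integral equation\<close>

lemma set_integrable_abs_diff_powr:
  assumes "(r::real) > -1"
  shows   "set_integrable lborel {0<..<1} (\<lambda>u. \<bar>u - u\<^sub>0\<bar> powr r)"
proof -
  define c where "c = \<bar>u\<^sub>0\<bar> + 1"
  have half: "integrable lborel (\<lambda>u. indicat_real {0..c} u *\<^sub>R u powr r)"
    using set_integrable_powr_from_0 [OF assms, of c] by (simp add: set_integrable_def c_def)
  have right: "integrable lborel (\<lambda>u. indicat_real {0..c} (u - u\<^sub>0) *\<^sub>R (u - u\<^sub>0) powr r)"
    using lborel_integrable_real_affine [OF half, of 1 "-u\<^sub>0"] by simp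
  have left: "integrable lborel (\<lambda>u. indicat_real {0..c} (u\<^sub>0 - u) *\<^sub>R (u\<^sub>0 - u) powr r)"
    using lborel_integrable_real_affine [OF half, of "-1" "u\<^sub>0"] by simp
  show ?thesis
    unfolding set_integrable_def
  proof (rule Bochner_Integration.integrable_bound [OF Bochner_Integration.integrable_add [OF left right]])
    show "AE u in lborel. norm (indicat_real {0<..<1} u *\<^sub>R \<bar>u - u\<^sub>0\<bar> powr r) \<le>
            norm (indicat_real {0..c} (u\<^sub>0 - u) *\<^sub>R (u\<^sub>0 - u) powr r +
                  indicat_real {0..c} (u - u\<^sub>0) *\<^sub>R (u - u\<^sub>0) powr r)"
      by (intro AE_I2) (auto simp: indicator_def c_def abs_if)
  qed measurable
qed

lemma abs_ln_quotient_ge: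
  assumes "0 < u" "u < 1" "0 < v" "v < (1::real)"
  shows   "\<bar>ln (u / v)\<bar> \<ge> \<bar>u - v\<bar>"
proof -
  have *: "y - x \<le> ln (y / x)" if "0 < x" "x \<le> y" "y < 1" for x y :: real
  proof -
    have "y - x \<le> (y - x) / y" using that by (simp add: le_divide_eq mult_left_le)
    also have "\<dots> = 1 - x / y" using that by (simp add: field_simps)
    also have "\<dots> \<le> - ln (x / y)" using ln_le_minus_one [of "x / y"] that by simp
    also have "\<dots> = ln (y / x)" using that by (simp add: ln_div)
    finally show ?thesis .
  qed
  show ?thesis
  proof (cases "v \<le> u")
    case True
    thus ?thesis using * [of v u] assms by simp
  next
    case False
    moreover have "ln (u / v) = - ln (v / u)" using assms by (simp add: ln_div)
    ultimately show ?thesis using * [of u v] assms by simp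
  qed
qed

lemma integral_powr_from_0:
  assumes "(e::real) > -1" "R \<ge> 0"
  shows   "(LINT t:{0..R}|lborel. t powr e) = R powr (e + 1) / (e + 1)"
proof -
  have "(LINT t:{0..R}|lborel. t powr e) = integral {0..R} (\<lambda>t. t powr e)"
    using assms by (intro set_borel_integral_eq_integral(2) set_integrable_powr_from_0)
  thus ?thesis
    using has_integral_powr_from_0 [OF assms] by (simp add: integral_unique)
qed

lemma norm_set_integral_le_except_0:
  fixes f :: "real \<Rightarrow> complex"
  assumes "set_integrable lborel X f" "set_integrable lborel X g" "\<And>t. t \<in> X \<Longrightarrow> t \<noteq> 0 \<Longrightarrow> norm (f t) \<le> g t"
  shows   "norm (LINT t:X|lborel. f t) \<le> (LINT t:X|lborel. g t)"
proof -
  have "norm (LINT t:X|lborel. f t) \<le> (LINT t:X|lborel. norm (f t))"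
    unfolding set_lebesgue_integral_def
    by (rule order_trans [OF integral_norm_bound]) (simp add: indicator_def)
  also have "\<dots> \<le> (LINT t:X|lborel. g t)"
    unfolding set_lebesgue_integral_def
  proof (rule integral_mono_AE)
    show "AE t in lborel. indicat_real X t *\<^sub>R norm (f t) \<le> indicat_real X t *\<^sub>R g t"
      using AE_lborel_singleton [of 0]
      by eventually_elim (use assms(3) in \<open>auto simp: indicator_def\<close>)
  qed (use assms(2) set_integrable_norm [OF assms(1)] in \<open>simp_all add: set_integrable_def\<close>)
  finally show ?thesis .
qed

context fox_decay
begin

text \<open>
  The constant of the bound below: one summand for the lower part of the line, one for the boundary
  terms and one for the remaining integral of the integration by parts.
\<close>

definition head_bound :: real where
  "head_bound = 2 * C * \<rho> / (1 - \<nu>) + 4 * C * \<rho> + 2 * F_bound * C * \<rho> / \<nu>"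

text \<open>
  The integral is bounded directly up to the height \<open>1 / \<bar>ln (\<rho> / y)\<bar>\<close> and by parts above it. The
  exponent \<open>\<nu> - 1 > -1\<close> makes the bound integrable across the singularity \<open>y = \<rho>\<close>.
\<close>

lemma norm_line_integral_le:
  assumes y: "y > 0" "y \<noteq> \<rho>" and R: "R \<ge> 0"
  shows   "norm (LINT t:{0..R}|lborel. line_pair (P y) 1 t) \<le> head_bound / y * \<bar>ln (\<rho> / y)\<bar> powr (\<nu> - 1)"
proof -
  define l where "l = \<bar>ln (\<rho> / y)\<bar>"
  define K where "K = C * \<rho> / y"
  have l: "l > 0" using y rho_pos by (simp add: l_def ln_div)
  have K: "K > 0" using y rho_pos C_pos by (simp add: K_def)
  note F0 = F_bound_nonneg
  have eqK: "head_bound / y = 2 * K / (1 - \<nu>) + (4 * K + 2 * F_bound * K / \<nu>)"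
    by (simp add: head_bound_def K_def add_divide_distrib mult_ac)
  have P_le: "norm (line_pair (P y) 1 t) \<le> 2 * K * t powr (-\<nu>)"
    and jump_le: "norm (jump y 1 t) \<le> 2 * K * t powr (-\<nu>)" if "t > 0" for t
    using norm_line_pair_P_le [of y 1 t] that y rho_pos by (simp_all add: K_def)
  have head: "norm (LINT t:{0..T}|lborel. line_pair (P y) 1 t) \<le> 2 * K / (1 - \<nu>) * l powr (\<nu> - 1)"
    if T: "0 \<le> T" "T \<le> 1 / l" for T
  proof -
    have "norm (LINT t:{0..T}|lborel. line_pair (P y) 1 t) \<le> (LINT t:{0..T}|lborel. 2 * K * t powr (-\<nu>))"
      using y nu T P_le
      by (intro norm_set_integral_le_except_0 set_integrable_line_pair set_integrable_mult_right set_integrable_powr_from_0) auto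
    also have "\<dots> = 2 * K * (T powr (1 - \<nu>) / (1 - \<nu>))"
      using nu T by (simp add: integral_powr_from_0)
    also have "\<dots> \<le> 2 * K * ((1 / l) powr (1 - \<nu>) / (1 - \<nu>))"
      using nu T K by (intro mult_left_mono divide_right_mono powr_mono2) auto
    also have "(1 / l) powr (1 - \<nu>) = l powr (\<nu> - 1)"
      using l by (simp add: powr_divide powr_minus_divide [symmetric])
    finally show ?thesis by simp
  qed
  show ?thesis
  proof (cases "R \<le> 1 / l")
    case True
    have "0 \<le> (4 * K + 2 * F_bound * K / \<nu>) * l powr (\<nu> - 1)"
      using K F0 nu by (intro mult_nonneg_nonneg add_nonneg_nonneg) auto
    thus ?thesis using head [OF R True] unfolding eqK l_def [symmetric] by (simp add: distrib_right)
  next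
    case False
    define r where "r = 1 / l"
    have r: "0 < r" "r < R" using False l by (auto simp: r_def)
    define X where "X = (LINT t:{r..R}|lborel. line_pair (P y) 1 t)"
    have "norm (LINT t:{r..R}|lborel. line_pair (FP y) 1 t) \<le> 2 * F_bound * K / \<nu> * r powr (-\<nu>)"
    proof -
      have FP_le: "norm (line_pair (FP y) 1 t) \<le> 2 * F_bound * K * t powr (-1 - \<nu>)" if "t > 0" for t
      proof -
        have "norm (line_pair (FP y) 1 t) \<le> 2 * F_bound * K * max 1 t powr (-1 - \<nu>)"
          using norm_line_pair_FP_le [of y 1 t] that y rho_pos by (simp add: K_def)
        also have "\<dots> \<le> 2 * F_bound * K * t powr (-1 - \<nu>)"
          using that nu K F0 by (intro mult_left_mono powr_mono2') auto
        finally show ?thesis .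
      qed
      have int: "has_bochner_integral lborel (\<lambda>t. indicat_real {r..R} t *\<^sub>R t powr (-1 - \<nu>))
                   (- (R powr (-\<nu>) / \<nu>) - - (r powr (-\<nu>) / \<nu>))"
      proof (rule has_bochner_integral_FTC_Icc)
        show "((\<lambda>t. - (t powr (-\<nu>) / \<nu>)) has_vector_derivative t powr (-1 - \<nu>)) (at t within {r..R})"
          if "r \<le> t" "t \<le> R" for t
          unfolding has_real_derivative_iff_has_vector_derivative [symmetric]
        proof -
          have "((\<lambda>t. - (t powr (-\<nu>) / \<nu>)) has_real_derivative t powr (-\<nu> - 1)) (at t within {r..R})"
            using that r nu by (auto intro!: derivative_eq_intros)
          moreover have "-\<nu> - 1 = -1 - \<nu>" by simp
          ultimately show "((\<lambda>t. - (t powr (-\<nu>) / \<nu>)) has_real_derivative t powr (-1 - \<nu>)) (at t within {r..R})"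
            by (simp only:)
        qed
        show "continuous_on {r..R} (\<lambda>t. t powr (-1 - \<nu>))"
          using r by (intro continuous_intros) auto
      qed (use r in auto)
      have "norm (LINT t:{r..R}|lborel. line_pair (FP y) 1 t) \<le>
              (LINT t:{r..R}|lborel. 2 * F_bound * K * t powr (-1 - \<nu>))"
        using y r int FP_le
        by (intro norm_set_integral_le_except_0 set_integrable_line_pair set_integrable_mult_right)
           (auto simp: set_integrable_def has_bochner_integral_iff)
      also have "\<dots> = 2 * F_bound * K * (r powr (-\<nu>) / \<nu> - R powr (-\<nu>) / \<nu>)"
        using int by (simp add: set_lebesgue_integral_def has_bochner_integral_iff)
      also have "\<dots> \<le> 2 * F_bound * K * (r powr (-\<nu>) / \<nu>)"
        using K F0 nu by (intro mult_left_mono) auto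
      finally show ?thesis by simp
    qed
    moreover have "norm (jump y 1 R) \<le> 2 * K * r powr (-\<nu>)"
      by (rule order_trans [OF jump_le]) (use r K nu in \<open>auto intro!: mult_left_mono powr_mono2'\<close>)
    moreover have "norm (jump y 1 r) \<le> 2 * K * r powr (-\<nu>)"
      using jump_le [of r] r by simp
    moreover have "norm (of_real (ln (\<rho> / y)) * X) \<le>
        norm (LINT t:{r..R}|lborel. line_pair (FP y) 1 t) + (norm (jump y 1 R) + norm (jump y 1 r))"
      unfolding X_def using r y
      by (subst integrate_line_pair_by_parts)
         (auto simp: norm_mult intro!: order_trans [OF norm_triangle_ineq4] add_left_mono)
    ultimately have "l * norm X \<le> (4 * K + 2 * F_bound * K / \<nu>) * r powr (-\<nu>)"
      by (simp add: norm_mult l_def distrib_right)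
    hence "norm X \<le> (4 * K + 2 * F_bound * K / \<nu>) * r powr (-\<nu>) / l"
      using l by (simp add: field_simps)
    also have "\<dots> = (4 * K + 2 * F_bound * K / \<nu>) * l powr (\<nu> - 1)"
      using l by (simp add: r_def powr_divide powr_diff powr_minus field_simps)
    finally have tail: "norm X \<le> \<dots>" .
    have "(LINT t:{0..R}|lborel. line_pair (P y) 1 t) = (LINT t:{0..r}|lborel. line_pair (P y) 1 t) + X"
    proof -
      have "{0..R} = {0..r} \<union> {r..R}" using r by auto
      moreover have "(LINT t:{0..r} \<union> {r..R}|lborel. line_pair (P y) 1 t) = (LINT t:{0..r}|lborel. line_pair (P y) 1 t) + X"
        unfolding X_def
        by (rule set_integral_Un_AE)
           (use y AE_lborel_singleton [of r] in \<open>auto intro!: set_integrable_line_pair elim!: eventually_mono\<close>)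
      ultimately show ?thesis by simp
    qed
    hence "norm (LINT t:{0..R}|lborel. line_pair (P y) 1 t) \<le>
             norm (LINT t:{0..r}|lborel. line_pair (P y) 1 t) + norm X"
      by (simp add: norm_triangle_ineq)
    also have "\<dots> \<le> 2 * K / (1 - \<nu>) * l powr (\<nu> - 1) + (4 * K + 2 * F_bound * K / \<nu>) * l powr (\<nu> - 1)"
      using r by (intro add_mono head tail) (auto simp: r_def)
    finally show ?thesis unfolding eqK l_def [symmetric] by (simp add: distrib_right)
  qed
qed

text \<open>
  Inserting the Mellin representation of \<open>F\<close> moves the factor \<open>u powr s\<close> of its kernel into the
  argument of \<open>P\<close>.
\<close>

lemma mellin_kernel_times_P:
  assumes "x > 0" "u \<in> {0<..<1}"
  shows   "Q u *\<^sub>R mellin_kernel s u * P x s = of_real (Q u / u) * P (x / u) s"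
proof -
  have "mellin_kernel s u * of_real x powr (-s) = exp (s * (of_real (ln u) - of_real (ln x)) - of_real (ln u))"
    using assms by (simp add: mellin_kernel_def powr_def Ln_of_real algebra_simps flip: exp_add)
  also have "\<dots> = exp (- s * of_real (ln (x / u))) / of_real u"
  proof -
    have "exp (complex_of_real (ln u)) = of_real u"
      using assms by (subst exp_of_real) simp
    thus ?thesis using assms by (simp add: exp_diff exp_add ln_div algebra_simps)
  qed
  also have "\<dots> = of_real (x / u) powr (-s) / of_real u"
    using assms Ln_of_real [of "x / u"] by (simp add: powr_def)
  finally have eq: "mellin_kernel s u * of_real x powr (-s) = of_real (x / u) powr (-s) / of_real u" .
  have "Q u *\<^sub>R mellin_kernel s u * P x s = of_real (Q u) * M s * (mellin_kernel s u * of_real x powr (-s))"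
    by (simp add: P_def scaleR_conv_of_real mult_ac)
  also have "\<dots> = of_real (Q u / u) * P (x / u) s"
    unfolding eq by (simp add: P_def)
  finally show ?thesis .
qed

lemma FP_eq_integral:
  assumes "x > 0" "Re s \<ge> 1"
  shows   "set_integrable lborel {0<..<1} (\<lambda>u. of_real (Q u / u) * P (x / u) s)"
          "FP x s = (LINT u:{0<..<1}|lborel. of_real (Q u / u) * P (x / u) s)"
proof -
  interpret Q: bounded_weight Q Q_bound by (rule bounded_weight_Q)
  have "set_integrable lborel {0<..<1} (\<lambda>u. (Q u *\<^sub>R mellin_kernel s u) * P x s)"
    by (intro set_integrable_mult_left Q.integrable assms)
  also have "?this \<longleftrightarrow> set_integrable lborel {0<..<1} (\<lambda>u. of_real (Q u / u) * P (x / u) s)"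
    by (rule set_integrable_cong) (use assms in \<open>auto simp only: mellin_kernel_times_P\<close>)
  finally show "set_integrable lborel {0<..<1} (\<lambda>u. of_real (Q u / u) * P (x / u) s)" .
  have "FP x s = (LINT u:{0<..<1}|lborel. (Q u *\<^sub>R mellin_kernel s u) * P x s)"
    unfolding FP_def F_def unit_mellin_def set_integral_mult_left ..
  also have "\<dots> = (LINT u:{0<..<1}|lborel. of_real (Q u / u) * P (x / u) s)"
    by (rule set_lebesgue_integral_cong, simp, intro allI impI) (rule mellin_kernel_times_P [OF assms(1)])
  finally show "FP x s = (LINT u:{0<..<1}|lborel. of_real (Q u / u) * P (x / u) s)" .
qed

lemma measurable_line_pair_quotient:
  assumes "x > 0"
  shows   "(\<lambda>(u, t). indicat_real {0<..<1} u *\<^sub>R (of_real (Q u / u) * line_pair (P (x / u)) 1 t)) \<in>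
             borel_measurable (lborel \<Otimes>\<^sub>M lborel)"
proof -
  interpret Q: bounded_weight Q Q_bound by (rule bounded_weight_Q)
  define m where "m = (\<lambda>t. M (Complex 1 t))"
  have "continuous_on UNIV m"
    unfolding m_def
  proof (rule continuous_on_line [where f = M])
    show "isCont M s" if "Re s \<ge> 1" for s
      using M_has_field_derivative [OF that] by (rule DERIV_isCont)
  qed simp
  hence [measurable]: "m \<in> borel_measurable borel"
    by (rule borel_measurable_continuous_onI)
  define e where "e = (\<lambda>u t. exp (- (1 + \<i> * of_real t) * of_real (ln (x / u))))"
  have [measurable]: "case_prod e \<in> borel_measurable (lborel \<Otimes>\<^sub>M lborel)"
    unfolding e_def by measurable
  have [measurable]: "(\<lambda>(u, t). e u (-t)) \<in> borel_measurable (lborel \<Otimes>\<^sub>M lborel)"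
    unfolding e_def by measurable
  have "(\<lambda>z. indicat_real {0<..<1} (fst z) *\<^sub>R (of_real (Q (fst z) / fst z) *
           (m (snd z) * case_prod e z + m (- snd z) * (\<lambda>(u, t). e u (-t)) z))) \<in> borel_measurable (lborel \<Otimes>\<^sub>M lborel)"
    by measurable
  also have "(\<lambda>z. indicat_real {0<..<1} (fst z) *\<^sub>R (of_real (Q (fst z) / fst z) *
           (m (snd z) * case_prod e z + m (- snd z) * (\<lambda>(u, t). e u (-t)) z))) =
         (\<lambda>(u, t). indicat_real {0<..<1} u *\<^sub>R (of_real (Q u / u) * line_pair (P (x / u)) 1 t))"
  proof (rule ext)
    fix z :: "real \<times> real"
    obtain u t where z: "z = (u, t)" by (cases z)
    have P: "P (x / u) (Complex 1 t) = m t * e u t" if "u > 0" for t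
      using that assms Ln_of_real [of "x / u"] by (simp add: P_def powr_def m_def e_def Complex_eq)
    show "indicat_real {0<..<1} (fst z) *\<^sub>R (of_real (Q (fst z) / fst z) *
             (m (snd z) * case_prod e z + m (- snd z) * (\<lambda>(u, t). e u (-t)) z)) =
          (\<lambda>(u, t). indicat_real {0<..<1} u *\<^sub>R (of_real (Q u / u) * line_pair (P (x / u)) 1 t)) z"
      using P [of t] P [of "-t"] by (simp add: z indicator_def line_pair_def)
  qed
  finally show ?thesis .
qed

lemma line_pair_FP_eq_integral:
  assumes "x > 0"
  shows   "line_pair (FP x) 1 t = (LINT u:{0<..<1}|lborel. of_real (Q u / u) * line_pair (P (x / u)) 1 t)"
  using set_integral_add(2) [OF FP_eq_integral(1) FP_eq_integral(1), of x "Complex 1 t" x "Complex 1 (-t)"] assms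
  by (simp add: line_pair_def FP_eq_integral(2) distrib_left)

lemma norm_line_pair_quotient_le:
  assumes "x > 0" "u \<in> {0<..<1}"
  shows   "norm (of_real (Q u / u) * line_pair (P (x / u)) 1 t) \<le> 2 * Q_bound * C * \<rho> / x"
proof -
  interpret Q: bounded_weight Q Q_bound by (rule bounded_weight_Q)
  have le: "norm (of_real (Q u / u) * P (x / u) (Complex 1 t)) \<le> Q_bound * (C * \<rho> / x)" for t
  proof -
    have "norm (P x (Complex 1 t)) \<le> C * \<rho> / x"
      using norm_P_le [of x "Complex 1 t" 1] abs_Re_le_cmod [of "Complex 1 t"] assms rho_pos by simp
    thus ?thesis
      unfolding mellin_kernel_times_P [OF assms, symmetric] norm_mult
      using Q.norm_integrand_le [OF assms(2), of "Complex 1 t"] Q.K_nonneg by (intro mult_mono) auto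
  qed
  have "norm (of_real (Q u / u) * line_pair (P (x / u)) 1 t) \<le> Q_bound * (C * \<rho> / x) + Q_bound * (C * \<rho> / x)"
    unfolding line_pair_def distrib_left by (rule order_trans [OF norm_triangle_ineq], rule add_mono) (rule le)+
  also have "\<dots> = 2 * Q_bound * C * \<rho> / x" by simp
  finally show ?thesis .
qed

definition head_integral :: "real \<Rightarrow> real \<Rightarrow> complex" where
  "head_integral y R = (LINT t:{0..R}|lborel. line_pair (P y) 1 t)"

lemma integral_line_pair_FP_swap:
  assumes x: "x > 0"
  shows   "(LINT t:{0..R}|lborel. line_pair (FP x) 1 t) =
             (LINT u:{0<..<1}|lborel. of_real (Q u / u) * head_integral (x / u) R)"
    and   "(\<lambda>u. indicat_real {0<..<1} u *\<^sub>R (of_real (Q u / u) * head_integral (x / u) R)) \<in> borel_measurable lborel"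
proof -
  define g where "g = (\<lambda>u t. indicat_real {0..R} t *\<^sub>R
                     (indicat_real {0<..<1} u *\<^sub>R (of_real (Q u / u) * line_pair (P (x / u)) 1 t)))"
  have [measurable]: "case_prod g \<in> borel_measurable (lborel \<Otimes>\<^sub>M lborel)"
  proof -
    note measurable_line_pair_quotient [OF x, measurable]
    have "(\<lambda>z. indicat_real {0..R} (snd z) *\<^sub>R
            (\<lambda>(u, t). indicat_real {0<..<1} u *\<^sub>R (of_real (Q u / u) * line_pair (P (x / u)) 1 t)) z)
            \<in> borel_measurable (lborel \<Otimes>\<^sub>M lborel)"
      by measurable
    thus ?thesis by (simp add: g_def case_prod_beta')
  qed
  have g_int: "integrable (lborel \<Otimes>\<^sub>M lborel) (case_prod g)"
  proof (rule integrableI_bounded_set [where A = "{0<..<1} \<times> {0..R}" and B = "2 * Q_bound * C * \<rho> / x"])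
    show "emeasure (lborel \<Otimes>\<^sub>M lborel) ({0<..<1::real} \<times> {0..R}) < \<infinity>"
      by (subst lborel.emeasure_pair_measure_Times)
         (auto simp: ennreal_mult_less_top emeasure_lborel_Icc_eq)
    show "AE z in lborel \<Otimes>\<^sub>M lborel. z \<in> {0<..<1} \<times> {0..R} \<longrightarrow> norm (case_prod g z) \<le> 2 * Q_bound * C * \<rho> / x"
    proof (intro AE_I2 impI)
      fix z :: "real \<times> real" assume z: "z \<in> {0<..<1} \<times> {0..R}"
      show "norm (case_prod g z) \<le> 2 * Q_bound * C * \<rho> / x"
        using norm_line_pair_quotient_le [OF x, of "fst z" "snd z"] z
        by (cases z) (simp add: g_def)
    qed
    show "AE z in lborel \<Otimes>\<^sub>M lborel. z \<notin> {0<..<1} \<times> {0..R} \<longrightarrow> case_prod g z = 0"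
      by (intro AE_I2) (auto simp: g_def indicator_def)
  qed auto
  have inner_t: "(LINT t|lborel. g u t) = indicat_real {0<..<1} u *\<^sub>R (of_real (Q u / u) * head_integral (x / u) R)" for u
  proof -
    have "(LINT t|lborel. g u t) = (LINT t:{0..R}|lborel. indicat_real {0<..<1} u *\<^sub>R (of_real (Q u / u) * line_pair (P (x / u)) 1 t))"
      by (simp only: g_def set_lebesgue_integral_def)
    also have "\<dots> = indicat_real {0<..<1} u *\<^sub>R (of_real (Q u / u) * head_integral (x / u) R)"
      unfolding head_integral_def set_integral_scaleR_right set_integral_mult_right ..
    finally show ?thesis .
  qed
  have inner_u: "(LINT u|lborel. g u t) = indicat_real {0..R} t *\<^sub>R line_pair (FP x) 1 t" for t
  proof -
    have "(LINT u|lborel. g u t) = indicat_real {0..R} t *\<^sub>R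
            (LINT u:{0<..<1}|lborel. of_real (Q u / u) * line_pair (P (x / u)) 1 t)"
      unfolding g_def set_lebesgue_integral_def by (rule integral_scaleR_right) 
    thus ?thesis by (simp add: line_pair_FP_eq_integral [OF x])
  qed
  have "(\<lambda>u. LINT t|lborel. g u t) \<in> borel_measurable lborel"
    by measurable
  thus "(\<lambda>u. indicat_real {0<..<1} u *\<^sub>R (of_real (Q u / u) * head_integral (x / u) R)) \<in> borel_measurable lborel"
    by (simp only: inner_t)
  show "(LINT t:{0..R}|lborel. line_pair (FP x) 1 t) =
             (LINT u:{0<..<1}|lborel. of_real (Q u / u) * head_integral (x / u) R)"
    using lborel_pair.Fubini_integral [OF g_int]
    by (simp only: inner_t inner_u set_lebesgue_integral_def)
qed

lemma head_bound_nonneg: "head_bound \<ge> 0"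
  unfolding head_bound_def using C_pos nu rho_pos F_bound_nonneg
  by (intro add_nonneg_nonneg divide_nonneg_nonneg mult_nonneg_nonneg) auto

theorem fox_line_majorant_integralegral_equation:
  assumes x: "0 < x" "x < \<rho>"
  shows   "set_integrable lborel {x / \<rho><..<1} (\<lambda>u. fox_H p q A a B b (x / u) * of_real (Q u / u))" (is ?th1)
    and   "fox_H p q A a B b x = of_real (1 / ln (\<rho> / x)) *
             (LINT u:{x / \<rho><..<1}|lborel. fox_H p q A a B b (x / u) * of_real (Q u / u))" (is ?th2)
proof -
  define u\<^sub>0 where "u\<^sub>0 = x / \<rho>"
  have u0: "0 < u\<^sub>0" "u\<^sub>0 < 1" using x rho_pos by (auto simp: u\<^sub>0_def)
  interpret Q: bounded_weight Q Q_bound by (rule bounded_weight_Q)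
  define c where "c = 2 * complex_of_real pi"
  have c: "c \<noteq> 0" by (simp add: c_def)
  \<comment> \<open>The point \<open>u\<^sub>0\<close>, where \<open>x / u = \<rho>\<close> and \<open>H\<close> may be undefined, is left out, so that the
     convergence holds everywhere and makes the limit measurable.\<close>
  define s where "s = (\<lambda>R u. indicat_real (- {u\<^sub>0}) u *\<^sub>R
                        (indicat_real {0<..<1} u *\<^sub>R (of_real (Q u / u) * head_integral (x / u) R)))"
  define f where "f = (\<lambda>u. indicat_real {u\<^sub>0<..<1} u *\<^sub>R
                        (of_real (Q u / u) * (c * fox_H p q A a B b (x / u))))"
  define w where "w = (\<lambda>u. indicat_real {0<..<1} u *\<^sub>R (Q_bound * head_bound / x * \<bar>u - u\<^sub>0\<bar> powr (\<nu> - 1)))"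
  have s_meas: "s R \<in> borel_measurable lborel" for R
    unfolding s_def by (intro borel_measurable_scaleR integral_line_pair_FP_swap(2) [OF x(1)]) simp
  have s_lim: "((\<lambda>R. s R u) \<longlongrightarrow> f u) at_top" for u
  proof (cases "u \<in> {0<..<1} \<and> u \<noteq> u\<^sub>0")
    case True
    hence y: "x / u > 0" "x / u \<noteq> \<rho>" using x rho_pos by (auto simp: u\<^sub>0_def field_simps)
    have H: "c * fox_H p q A a B b (x / u) = line_limit (x / u) 1"
      using fox_H_eq_line_limit [OF y, of 1] by (simp add: c_def)
    have "((\<lambda>R. s R u) \<longlongrightarrow> of_real (Q u / u) * (c * fox_H p q A a B b (x / u))) at_top"
      unfolding s_def H head_integral_def using True y
      by (auto intro!: tendsto_mult_left line_integral_tendsto simp del: of_real_divide)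
    moreover have "c * fox_H p q A a B b (x / u) = 0" if "u < u\<^sub>0"
    proof -
      have "\<rho> < x / u" using that True rho_pos by (simp add: u\<^sub>0_def field_simps)
      thus ?thesis by (simp add: fox_H_eq_0)
    qed
    ultimately show ?thesis using True by (cases "u < u\<^sub>0") (auto simp: f_def)
  qed (use u0 in \<open>auto simp: s_def f_def indicator_def\<close>)
  have f_meas: "f \<in> borel_measurable lborel"
  proof (rule borel_measurable_LIMSEQ_metric)
    show "s (real n) \<in> borel_measurable lborel" for n by (rule s_meas)
    show "(\<lambda>n. s (real n) u) \<longlonglongrightarrow> f u" for u
      by (rule filterlim_compose [OF s_lim filterlim_real_sequentially])
  qed
  have s_bound: "norm (s R u) \<le> w u" if R: "R \<ge> 0" for R u
  proof (cases "u \<in> {0<..<1} \<and> u \<noteq> u\<^sub>0")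
    case True
    hence u: "u \<in> {0<..<1}" "u \<noteq> u\<^sub>0" by auto
    have y: "x / u > 0" "x / u \<noteq> \<rho>" using x rho_pos u by (auto simp: u\<^sub>0_def field_simps)
    have eq: "\<rho> / (x / u) = u / u\<^sub>0" by (simp add: u\<^sub>0_def)
    have "norm (head_integral (x / u) R) \<le> head_bound / (x / u) * \<bar>ln (u / u\<^sub>0)\<bar> powr (\<nu> - 1)"
      using norm_line_integral_le [OF y R] unfolding head_integral_def eq .
    also have "\<dots> \<le> head_bound / (x / u) * \<bar>u - u\<^sub>0\<bar> powr (\<nu> - 1)"
      using abs_ln_quotient_ge [of u u\<^sub>0] u u0 x nu head_bound_nonneg
      by (intro mult_left_mono powr_mono2') auto
    finally have "norm (head_integral (x / u) R) \<le> head_bound / (x / u) * \<bar>u - u\<^sub>0\<bar> powr (\<nu> - 1)" .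
    moreover have "norm (of_real (Q u / u) :: complex) \<le> Q_bound / u"
      using Q.weight_le [OF u(1)] u by (simp add: norm_divide divide_right_mono)
    ultimately have "norm (of_real (Q u / u) * head_integral (x / u) R) \<le>
                       (Q_bound / u) * (head_bound / (x / u) * \<bar>u - u\<^sub>0\<bar> powr (\<nu> - 1))"
      unfolding norm_mult using u Q.K_nonneg by (intro mult_mono) auto
    also have "\<dots> = Q_bound * head_bound / x * \<bar>u - u\<^sub>0\<bar> powr (\<nu> - 1)"
      using u by simp
    finally show ?thesis using u by (simp add: s_def w_def)
  next
    case False
    have "w u \<ge> 0"
      unfolding w_def using Q.K_nonneg head_bound_nonneg x by simp
    thus ?thesis using False by (auto simp: s_def indicator_def)
  qed
  have w_int: "integrable lborel w"
    using set_integrable_mult_right [OF set_integrable_abs_diff_powr [of "\<nu> - 1" u\<^sub>0], of "Q_bound * head_bound / x"] nu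
    by (simp only: w_def set_integrable_def)
  have AE_lim: "AE u in lborel. ((\<lambda>R. s R u) \<longlongrightarrow> f u) at_top"
    using s_lim by (intro AE_I2)
  have AE_bound: "\<forall>\<^sub>F R in at_top. AE u in lborel. norm (s R u) \<le> w u"
    using eventually_ge_at_top [of 0] by eventually_elim (use s_bound in \<open>intro AE_I2\<close>)
  note dct = f_meas s_meas w_int AE_lim AE_bound
  have f_int: "integrable lborel f"
    by (rule integrable_dominated_convergence_at_top [OF dct])
  have lim1: "((\<lambda>R. LINT u|lborel. s R u) \<longlongrightarrow> (LINT u|lborel. f u)) at_top"
    by (rule integral_dominated_convergence_at_top [OF dct])
  define h where "h = (\<lambda>u. fox_H p q A a B b (x / u) * of_real (Q u / u))"
  have f_eq: "f u = c * (indicat_real {u\<^sub>0<..<1} u *\<^sub>R h u)" for u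
    by (simp add: f_def h_def)
  have "(\<lambda>u. inverse c * f u) = (\<lambda>u. indicat_real {u\<^sub>0<..<1} u *\<^sub>R h u)"
    using c by (simp add: f_eq fun_eq_iff)
  moreover have "integrable lborel (\<lambda>u. inverse c * f u)"
    by (intro integrable_mult_right f_int)
  ultimately show ?th1
    unfolding set_integrable_def u\<^sub>0_def [symmetric] h_def [symmetric] by (simp only:)
  have "ln (\<rho> / x) \<noteq> 0" using x rho_pos by (simp add: ln_div)
  have s_eq: "(LINT u|lborel. s R u) = of_real (ln (\<rho> / x)) * head_integral x R + \<i> * jump x 1 R" if "R \<ge> 0" for R
  proof -
    have "(LINT u|lborel. s R u) = (LINT u:{0<..<1}|lborel. of_real (Q u / u) * head_integral (x / u) R)"
      unfolding set_lebesgue_integral_def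
    proof (rule integral_cong_AE)
      show "AE u in lborel. s R u = indicat_real {0<..<1} u *\<^sub>R (of_real (Q u / u) * head_integral (x / u) R)"
        using AE_lborel_singleton [of u\<^sub>0] by eventually_elim (simp add: s_def)
    qed (use s_meas integral_line_pair_FP_swap(2) [OF x(1)] in auto)
    also have "\<dots> = (LINT t:{0..R}|lborel. line_pair (FP x) 1 t)"
      by (rule integral_line_pair_FP_swap(1) [OF x(1), symmetric])
    also have "\<dots> = of_real (ln (\<rho> / x)) * head_integral x R + \<i> * jump x 1 R"
      using integrate_line_pair_by_parts [of x 1 0 R] that x by (simp add: head_integral_def jump_0)
    finally show ?thesis .
  qed
  have "((\<lambda>R. of_real (ln (\<rho> / x)) * head_integral x R + \<i> * jump x 1 R) \<longlongrightarrow>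
           of_real (ln (\<rho> / x)) * line_limit x 1 + \<i> * 0) at_top"
    unfolding head_integral_def using x by (intro tendsto_intros line_integral_tendsto jump_tendsto_0) auto
  hence "((\<lambda>R. LINT u|lborel. s R u) \<longlongrightarrow> of_real (ln (\<rho> / x)) * line_limit x 1 + \<i> * 0) at_top"
    by (rule Lim_transform_eventually)
       (use eventually_ge_at_top [of 0] in \<open>eventually_elim, simp add: s_eq\<close>)
  with lim1 have "(LINT u|lborel. f u) = of_real (ln (\<rho> / x)) * line_limit x 1 + \<i> * 0"
    by (intro tendsto_unique [of at_top]) auto
  also have "line_limit x 1 = c * fox_H p q A a B b x"
    using fox_H_eq_line_limit [of x 1] x by (simp add: c_def)
  also have "(LINT u|lborel. f u) = c * (LINT u:{u\<^sub>0<..<1}|lborel. h u)"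
    unfolding f_eq set_lebesgue_integral_def by (rule integral_mult_right_zero)
  finally have "(LINT u:{u\<^sub>0<..<1}|lborel. h u) = of_real (ln (\<rho> / x)) * fox_H p q A a B b x"
    using c by simp
  thus ?th2
    using \<open>ln (\<rho> / x) \<noteq> 0\<close> unfolding u\<^sub>0_def [symmetric] h_def [symmetric] by simp
qed

end

theorem theorem8:
  fixes p q :: nat and A a B b :: "nat \<Rightarrow> real" and x :: real
  assumes "p \<ge> 1" and "q \<ge> 1"
    and "\<And>i. i \<in> {1..p} \<Longrightarrow> A i > 0" and "\<And>j. j \<in> {1..q} \<Longrightarrow> B j > 0"
    and "\<And>i. i \<in> {1..p} \<Longrightarrow> a i \<ge> 0" and "\<And>j. j \<in> {1..q} \<Longrightarrow> b j \<ge> 0"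
    and "fox_mu p q a b > 0"
    and "fox_rho p q A B \<le> 1"
    and "(\<Sum>i=1..p. A i) = (\<Sum>j=1..q. B j)"
    and "x \<in> {0<..<fox_rho p q A B}"
  shows "set_integrable lborel {x / fox_rho p q A B<..<1}
           (\<lambda>u. fox_H p q A a B b (x / u) * of_real (fox_Q p q A a B b u / u)) \<and>
         fox_H p q A a B b x =
           of_real (1 / ln (fox_rho p q A B / x)) *
           (LINT u:{x / fox_rho p q A B<..<1}|lborel.
              fox_H p q A a B b (x / u) * of_real (fox_Q p q A a B b u / u))"
proof -
  interpret fox_params p q A a B b
    by standard (use assms in auto)
  obtain \<nu> C where "0 < \<nu>" "\<nu> < 1" "C > 0"
    "\<And>s. Re s \<ge> 1 \<Longrightarrow> norm (M s) \<le> C * \<rho> powr Re s * norm s powr (-\<nu>)"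
    using M_decay_exists by blast
  then interpret fox_decay p q A a B b \<nu> C
    by unfold_locales
  show ?thesis
    using fox_line_majorant_integralegral_equation [of x] assms(10) unfolding \<rho>_def by auto
qed

end
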